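(* Let $n,k,s\ge0$. The $\mathbb{Q}$-vector space $V(n)$ has the structure of an $\mathfrak{S}_n$-module given by $s_i.v=\tau_i(v)$ for $1\le i\le n-1$ and $v\in V(n)$. The subspaces $V(n,k,s)\subseteq V(n,k)\subseteq V(n)$ are submodules for this action. The representing matrices of every permutation $w\in\mathfrak{S}_n$ with respect to the skein bases $NC(n)$, $NC(n,k)$, $NC(n,k,s)$ of $V(n)$, $V(n,k)$, $V(n,k,s)$ have entries in $\mathbb{Z}$.
   Context: $[n]=\{1,\dots,n\}$, $s_i=(i,i+1)\in\mathfrak{S}_n$. For $w\in\mathfrak{S}_n$ and a set partition $\pi$ of $[n]$, $w(\pi)$ is the set partition in which $w(a),w(b)$ share a block iff $a,b$ share a block of $\pi$; $B_i(\pi)$ is the block of $\pi$ containing $i$. A set partition is noncrossing if whenever $a<b<c<d$ with $a,c$ in one block and $b,d$ in one block, all four are in the same block. $NC(n)$ is the set of noncrossing partitions of $[n]$, $NC(n,k)$ those with exactly $k$ blocks, $NC(n,k,s)$ those with exactly $k$ blocks of which exactly $s$ are singletons. A set partition $\pi$ is almost noncrossing if it is not noncrossing but $s_i(\pi)$ is noncrossing for some $i$; then $\pi$ crosses at $i$. Skein map: for $\pi$ almost noncrossing crossing at $i$, write $B_i(\pi)=\{i,a_1,\dots,a_k\}$, $B_{i+1}(\pi)=\{i+1,b_1,\dots,b_\ell\}$ ($k,\ell\ge1$); let $\pi_1=s_i(\pi)$ and let $\pi_2,\pi_3,\pi_4$ be obtained from $\pi$ by replacing $B_i(\pi),B_{i+1}(\pi)$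 by $\{i,i+1\},\{a_1..a_k,b_1..b_\ell\}$ (for $\pi_2$), $\{i,i+1,a_1..a_k\},\{b_1..b_\ell\}$ (for $\pi_3$), $\{i,i+1,b_1..b_\ell\},\{a_1..a_k\}$ (for $\pi_4$). Then $\sigma(\pi)=\pi_1+\pi_2-\pi_3-\pi_4$ if $k,\ell\ge2$, with the $\pi_3$ term deleted if $\ell=1$ and the $\pi_4$ term deleted if $k=1$; this is a linear combination of noncrossing partitions, independent of the chosen crossing index. $V(n)$, $V(n,k)$, $V(n,k,s)$ are the $\mathbb{Q}$-vector spaces with bases (called skein bases) $NC(n)$, $NC(n,k)$, $NC(n,k,s)$. For $1\le i\le n-1$, $\tau_i$ is the linear operator on $V(n)$ defined on $\pi\in NC(n)$ by: $\tau_i(\pi)=s_i(\pi)$ if $s_i(\pi)$ is noncrossing and $B_i(\pi)\ne B_{i+1}(\pi)$; $\tau_i(\pi)=-\pi$ if $B_i(\pi)=B_{i+1}(\pi)$; $\tau_i(\pi)=\sigma(s_i(\pi))$ if $s_i(\pi)$ is not noncrossing (then it is almost noncrossing, crossing at $i$). *)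

theory Defs
  imports
    Complex_Main
    "HOL-Algebra.Sym_Groups"
    "HOL-Algebra.Group_Action"
    "HOL-Library.Poly_Mapping"
    "HOL-Library.Disjoint_Sets"
begin

section \<open>Rational vector spaces with a distinguished basis\<close>

text \<open>
  The ambient space of finitely supported formal rational combinations of elements
  of a type. The space with basis a set \<open>X\<close> is the subspace of combinations supported
  on \<open>X\<close>.
\<close>

definition qscale :: "rat \<Rightarrow> ('a \<Rightarrow>\<^sub>0 rat) \<Rightarrow> ('a \<Rightarrow>\<^sub>0 rat)"
  where "qscale c v = Poly_Mapping.map ((*) c) v"

lemma lookup_qscale: "Poly_Mapping.lookup (qscale c v) x = c * Poly_Mapping.lookup v x"
  by (simp add: qscale_def Poly_Mapping.map.rep_eq when_def)

interpretation qfree: vector_space "qscale :: rat \<Rightarrow> ('a \<Rightarrow>\<^sub>0 rat) \<Rightarrow> _"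
  by unfold_locales
    (auto intro!: poly_mapping_eqI simp: lookup_qscale lookup_add algebra_simps)

definition basis_vec :: "'a \<Rightarrow> ('a \<Rightarrow>\<^sub>0 rat)"
  where "basis_vec x = Poly_Mapping.single x 1"

definition qspace :: "'a set \<Rightarrow> ('a \<Rightarrow>\<^sub>0 rat) set"
  where "qspace X = {v. Poly_Mapping.keys v \<subseteq> X}"

definition linear_extension :: "('a \<Rightarrow> ('b \<Rightarrow>\<^sub>0 rat)) \<Rightarrow> ('a \<Rightarrow>\<^sub>0 rat) \<Rightarrow> ('b \<Rightarrow>\<^sub>0 rat)"
  where "linear_extension f v =
    (\<Sum>x\<in>Poly_Mapping.keys v. qscale (Poly_Mapping.lookup v x) (f x))"

definition linear_on_space :: "('a \<Rightarrow>\<^sub>0 rat) set \<Rightarrow> (('a \<Rightarrow>\<^sub>0 rat) \<Rightarrow> ('b \<Rightarrow>\<^sub>0 rat)) \<Rightarrow> bool"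
  where "linear_on_space V f \<longleftrightarrow>
    (\<forall>u\<in>V. \<forall>v\<in>V. f (u + v) = f u + f v) \<and>
    (\<forall>c. \<forall>v\<in>V. f (qscale c v) = qscale c (f v))"

text \<open>
  A \<open>G\<close>-module structure on a subspace \<open>V\<close>: a (left) action of \<open>G\<close> on the set \<open>V\<close>
  by linear maps. The library's \<open>group_action\<close> makes \<open>\<rho>\<close> a homomorphism into the group
  of bijections of \<open>V\<close>.
\<close>

definition group_module ::
  "('g, 'm) monoid_scheme \<Rightarrow> ('a \<Rightarrow>\<^sub>0 rat) set \<Rightarrow> ('g \<Rightarrow> ('a \<Rightarrow>\<^sub>0 rat) \<Rightarrow> ('a \<Rightarrow>\<^sub>0 rat)) \<Rightarrow> bool"
  where "group_module G V \<rho> \<longleftrightarrow>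
    qfree.subspace V \<and> group_action G V \<rho> \<and> (\<forall>g\<in>carrier G. linear_on_space V (\<rho> g))"

definition group_submodule ::
  "('g, 'm) monoid_scheme \<Rightarrow> ('a \<Rightarrow>\<^sub>0 rat) set \<Rightarrow> ('g \<Rightarrow> ('a \<Rightarrow>\<^sub>0 rat) \<Rightarrow> ('a \<Rightarrow>\<^sub>0 rat)) \<Rightarrow>
    ('a \<Rightarrow>\<^sub>0 rat) set \<Rightarrow> bool"
  where "group_submodule G V \<rho> W \<longleftrightarrow>
    W \<subseteq> V \<and> qfree.subspace W \<and> (\<forall>g\<in>carrier G. \<forall>v\<in>W. \<rho> g v \<in> W)"

text \<open>
  Entry in row \<open>y\<close> and column \<open>x\<close> of the representing matrix of \<open>f\<close>: the coefficient of
  the basis vector \<open>y\<close> in the image of the basis vector \<open>x\<close>. For an invariant subspace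
  \<open>qspace X\<close>, the entries with \<open>x, y \<in> X\<close> form the representing matrix of the restriction.
\<close>

definition matrix_entry :: "(('a \<Rightarrow>\<^sub>0 rat) \<Rightarrow> ('b \<Rightarrow>\<^sub>0 rat)) \<Rightarrow> 'b \<Rightarrow> 'a \<Rightarrow> rat"
  where "matrix_entry f y x = Poly_Mapping.lookup (f (basis_vec x)) y"

definition integral_matrix :: "(('a \<Rightarrow>\<^sub>0 rat) \<Rightarrow> ('a \<Rightarrow>\<^sub>0 rat)) \<Rightarrow> 'a set \<Rightarrow> bool"
  where "integral_matrix f X \<longleftrightarrow> (\<forall>x\<in>X. \<forall>y\<in>X. matrix_entry f y x \<in> \<int>)"


section \<open>Noncrossing partitions\<close>

definition noncrossing :: "nat set set \<Rightarrow> bool"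
  where "noncrossing \<pi> \<longleftrightarrow>
    (\<forall>a b c d. \<forall>A\<in>\<pi>. \<forall>B\<in>\<pi>.
      a < b \<and> b < c \<and> c < d \<and> a \<in> A \<and> c \<in> A \<and> b \<in> B \<and> d \<in> B \<longrightarrow> A = B)"

definition NC :: "nat \<Rightarrow> nat set set set"
  where "NC n = {\<pi>. partition_on {1..n} \<pi> \<and> noncrossing \<pi>}"

definition NC_blocks :: "nat \<Rightarrow> nat \<Rightarrow> nat set set set"
  where "NC_blocks n k = {\<pi> \<in> NC n. card \<pi> = k}"

definition NC_singletons :: "nat \<Rightarrow> nat \<Rightarrow> nat \<Rightarrow> nat set set set"
  where "NC_singletons n k s = {\<pi> \<in> NC_blocks n k. card {B \<in> \<pi>. card B = 1} = s}"

definition perm_partition :: "(nat \<Rightarrow> nat) \<Rightarrow> nat set set \<Rightarrow> nat set set"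
  where "perm_partition w \<pi> = (\<lambda>B. w ` B) ` \<pi>"

definition adj_transp :: "nat \<Rightarrow> nat \<Rightarrow> nat"
  where "adj_transp i = transpose i (i + 1)"

definition block_of :: "nat set set \<Rightarrow> nat \<Rightarrow> nat set"
  where "block_of \<pi> i = (THE B. B \<in> \<pi> \<and> i \<in> B)"


section \<open>The skein map and the operators\<close>

text \<open>
  The skein map, resolved at an index \<open>i\<close> at which the almost noncrossing partition \<open>\<pi>\<close>
  crosses; \<open>A\<close> and \<open>B\<close> are the sets of the \<open>a\<close>'s and of the \<open>b\<close>'s (both nonempty in that
  situation). The value at other arguments is irrelevant.
\<close>

definition skein :: "nat \<Rightarrow> nat set set \<Rightarrow> (nat set set \<Rightarrow>\<^sub>0 rat)"
  where "skein i \<pi> =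
    (let A = block_of \<pi> i - {i};
         B = block_of \<pi> (i + 1) - {i + 1};
         R = \<pi> - {block_of \<pi> i, block_of \<pi> (i + 1)};
         \<pi>1 = perm_partition (adj_transp i) \<pi>;
         \<pi>2 = R \<union> {{i, i + 1}, A \<union> B};
         \<pi>3 = R \<union> {{i, i + 1} \<union> A, B};
         \<pi>4 = R \<union> {{i, i + 1} \<union> B, A}
     in basis_vec \<pi>1 + basis_vec \<pi>2
        - (if card B = 1 then 0 else basis_vec \<pi>3)
        - (if card A = 1 then 0 else basis_vec \<pi>4))"

definition tau_basis :: "nat \<Rightarrow> nat set set \<Rightarrow> (nat set set \<Rightarrow>\<^sub>0 rat)"
  where "tau_basis i \<pi> =
    (if block_of \<pi> i = block_of \<pi> (i + 1) then - basis_vec \<pi>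
     else if noncrossing (perm_partition (adj_transp i) \<pi>)
       then basis_vec (perm_partition (adj_transp i) \<pi>)
     else skein i (perm_partition (adj_transp i) \<pi>))"

definition tau :: "nat \<Rightarrow> (nat set set \<Rightarrow>\<^sub>0 rat) \<Rightarrow> (nat set set \<Rightarrow>\<^sub>0 rat)"
  where "tau i = linear_extension (tau_basis i)"

end

theory Submission
  imports Defs
begin

text \<open>
  The idea is to realise \<open>V(n)\<close> inside a representation that is visibly one of the symmetric
  group, so that no Coxeter relation between the \<open>\<tau>\<^sub>i\<close> has to be verified. Every set
  partition \<open>\<pi>\<close>, crossing or not, is sent to a function on tuples \<open>(u, D, k, s, t)\<close>: with
  \<open>B\<^sub>1, \<dots>, B\<^sub>k\<close> the nonsingleton blocks and \<open>D\<close> their union, its value is a Vandermonde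
  product over \<open>D\<close> times \<open>det(1[s\<^sub>i \<in> B\<^sub>j]) * det(1[t\<^sub>i \<in> B\<^sub>j])\<close>, for \<open>s\<close> and \<open>t\<close> without a common
  value. The symmetric group acts on these functions by moving the arguments, and the
  Vandermonde factor supplies the sign by which \<open>\<tau>\<^sub>i\<close> differs from a permutation of partitions.
  The skein relation is an identity for products of two alternating bilinear forms, in which two
  further terms belong to singleton blocks and vanish because \<open>s\<close> and \<open>t\<close> share no value.
  The functions of noncrossing partitions are linearly independent: evaluation at the block minima
  and maxima is triangular with respect to the sum of \<open>max B - min B\<close>, since a noncrossing
  partition is determined by its sets of minima and of maxima. Hence the image of \<open>V(n)\<close>, being
  stable under adjacent transpositions, is stable under the whole group.
\<close>

section \<open>Determinants of block incidences\<close>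

text \<open>Leibniz expansion of the determinant with rows \<open>s i\<close> and columns
  \<open>Bs ! j\<close>. The blocks form a list because the order of the columns fixes the
  sign.\<close>

definition indicator_det :: "nat set list \<Rightarrow> (nat \<Rightarrow> nat) \<Rightarrow> rat"
  where "indicator_det Bs s = (\<Sum>\<sigma> | \<sigma> permutes {..<length Bs}.
    of_int (sign \<sigma>) * (\<Prod>j<length Bs. of_bool (s (\<sigma> j) \<in> Bs ! j)))"

lemma indicator_det_permute_list:
  assumes p: "p permutes {..<length Bs}"
  shows "indicator_det (permute_list p Bs) s = of_int (sign p) * indicator_det Bs s"
proof -
  let ?n = "length Bs"
  let ?P = "{\<sigma>. \<sigma> permutes {..<?n}}"
  have "indicator_det (permute_list p Bs) s = (\<Sum>\<sigma>\<in>?P.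
      of_int (sign \<sigma>) * (\<Prod>j<?n. of_bool (s (\<sigma> j) \<in> Bs ! p j)))"
    unfolding indicator_det_def using p
    by (intro sum.cong) (auto simp: permute_list_nth intro!: prod.cong)
  \<comment> \<open>After composition with \<open>p\<close> every factor is a function of
    \<open>p j\<close>, so the product can be reindexed.\<close>
  also have "\<dots> = (\<Sum>\<sigma>\<in>?P. of_int (sign (\<sigma> \<circ> p)) * (\<Prod>j<?n. of_bool (s ((\<sigma> \<circ> p) j) \<in> Bs ! p j)))"
    by (rule sum_permutations_compose_right[OF p])
  also have "\<dots> = (\<Sum>\<sigma>\<in>?P. of_int (sign p) * (of_int (sign \<sigma>) * (\<Prod>j<?n. of_bool (s (\<sigma> j) \<in> Bs ! j))))"
  proof (rule sum.cong)
    fix \<sigma> assume "\<sigma> \<in> ?P"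
    then have sg: "sign (\<sigma> \<circ> p) = sign p * sign \<sigma>"
      using p by (metis finite_lessThan mem_Collect_eq mult.commute permutation_permutes sign_compose)
    have "(\<Prod>j<?n. of_bool (s (\<sigma> j) \<in> Bs ! j)) = (\<Prod>j<?n. of_bool (s (\<sigma> (p j)) \<in> Bs ! p j) :: rat)"
      using prod.permute[OF p, of "\<lambda>j. of_bool (s (\<sigma> j) \<in> Bs ! j)"] by (simp add: o_def)
    then show "of_int (sign (\<sigma> \<circ> p)) * (\<Prod>j<?n. of_bool (s ((\<sigma> \<circ> p) j) \<in> Bs ! p j)) =
      of_int (sign p) * (of_int (sign \<sigma>) * (\<Prod>j<?n. of_bool (s (\<sigma> j) \<in> Bs ! j) :: rat))"
      by (simp add: sg)
  qed simp
  finally show ?thesis by (simp add: indicator_det_def sum_distrib_left)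
qed

text \<open>Separates the factors of the first two columns, so that the summand is visibly additive
  in each of these blocks.\<close>

lemma indicator_det_Cons2:
  "indicator_det (X # Y # Bs) s = (\<Sum>\<sigma> | \<sigma> permutes {..<Suc (Suc (length Bs))}.
    of_int (sign \<sigma>) * (\<Prod>j<length Bs. of_bool (s (\<sigma> (Suc (Suc j))) \<in> Bs ! j)) *
      of_bool (s (\<sigma> 0) \<in> X) * of_bool (s (\<sigma> (Suc 0)) \<in> Y))"
  unfolding indicator_det_def by (simp add: prod.lessThan_Suc_shift mult_ac del: prod.lessThan_Suc)

lemma of_bool_Un_disjnt: "X \<inter> Y = {} \<Longrightarrow> of_bool (x \<in> X \<union> Y) = (of_bool (x \<in> X) + of_bool (x \<in> Y) :: rat)"
  by auto

lemma indicator_det_Un_left: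
  assumes "X \<inter> X' = {}"
  shows "indicator_det ((X \<union> X') # Y # Bs) s = indicator_det (X # Y # Bs) s + indicator_det (X' # Y # Bs) s"
  unfolding indicator_det_Cons2 of_bool_Un_disjnt[OF assms] by (simp add: algebra_simps sum.distrib)

lemma indicator_det_swap: "indicator_det (Y # X # Bs) s = - indicator_det (X # Y # Bs) s"
proof -
  let ?p = "transpose 0 (Suc 0)" and ?L = "X # Y # Bs"
  have p: "?p permutes {..<length ?L}" by (rule permutes_swap_id) auto
  have "permute_list ?p ?L = Y # X # Bs"
    by (rule nth_equalityI) (auto simp: permute_list_nth[OF p] nth_Cons transpose_def split: nat.splits)
  then show ?thesis using indicator_det_permute_list[OF p, of s] by (simp add: sign_swap_id)
qed

lemma indicator_det_Un_right:
  assumes "Y \<inter> Y' = {}"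
  shows "indicator_det (X # (Y \<union> Y') # Bs) s = indicator_det (X # Y # Bs) s + indicator_det (X # Y' # Bs) s"
  using indicator_det_Un_left[OF assms, of X Bs s] by (simp add: indicator_det_swap[of X])

lemma indicator_det_same: "indicator_det (X # X # Bs) s = 0"
  using indicator_det_swap[of X X Bs s] by simp

text \<open>Some Leibniz term is nonzero, and its permutation matches the points of \<open>s\<close>
  with the blocks.\<close>

lemma indicator_det_nonzeroE:
  assumes "indicator_det Bs s \<noteq> 0"
  obtains \<sigma> where "\<sigma> permutes {..<length Bs}" "\<And>j. j < length Bs \<Longrightarrow> s (\<sigma> j) \<in> Bs ! j"
proof -
  obtain \<sigma> where "\<sigma> permutes {..<length Bs}" "(\<Prod>j<length Bs. of_bool (s (\<sigma> j) \<in> Bs ! j)) \<noteq> (0 :: rat)"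
    using assms unfolding indicator_det_def by (auto elim: sum.not_neutral_contains_not_neutral)
  then show ?thesis by (intro that[of \<sigma>]) auto
qed

lemma indicator_det_image:
  assumes "bij w"
  shows "indicator_det (map ((`) w) Bs) s = indicator_det Bs (inv' w \<circ> s)"
proof -
  have "x \<in> w ` B \<longleftrightarrow> inv' w x \<in> B" for x B
    using assms by (metis bij_inv_eq_iff image_iff)
  then show ?thesis unfolding indicator_det_def
    by (auto intro!: sum.cong prod.cong)
qed

text \<open>Disjointness makes the incidence matrix the identity matrix, so only \<open>id\<close>
  contributes.\<close>

lemma indicator_det_transversal:
  assumes "distinct Bs" "disjoint (set Bs)" "\<And>j. j < length Bs \<Longrightarrow> s j \<in> Bs ! j"
  shows "indicator_det Bs s = 1"
proof -
  let ?P = "{\<sigma>. \<sigma> permutes {..<length Bs}}"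
  have "\<sigma> = id" if \<sigma>: "\<sigma> permutes {..<length Bs}"
      and h: "(\<Prod>j<length Bs. of_bool (s (\<sigma> j) \<in> Bs ! j)) \<noteq> (0 :: rat)" for \<sigma>
  proof
    fix j
    show "\<sigma> j = id j"
    proof (cases "j < length Bs")
      case True
      then have j': "\<sigma> j < length Bs" using permutes_in_image[OF \<sigma>] by auto
      have "s (\<sigma> j) \<in> Bs ! j" using h True by (auto split: if_splits)
      moreover have "s (\<sigma> j) \<in> Bs ! \<sigma> j" by (rule assms) fact
      ultimately have "Bs ! \<sigma> j = Bs ! j"
        using assms(2) True j' unfolding disjoint_def by (meson disjoint_iff nth_mem)
      then show ?thesis using assms(1) True j' by (simp add: nth_eq_iff_index_eq)
    next
      case False
      then show ?thesis using permutes_not_in[OF \<sigma>] by auto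
    qed
  qed
  then have "indicator_det Bs s = (\<Sum>\<sigma>\<in>{id}. of_int (sign \<sigma>) * (\<Prod>j<length Bs. of_bool (s (\<sigma> j) \<in> Bs ! j)))"
    unfolding indicator_det_def
    by (intro sum.mono_neutral_right) (auto simp: finite_permutations permutes_id)
  then show ?thesis using assms(3) by (simp add: sign_id)
qed

text \<open>The enumeration of \<open>P\<close> is immaterial: both determinants change by the same sign.\<close>

definition block_form :: "nat set set \<Rightarrow> (nat \<Rightarrow> nat) \<Rightarrow> (nat \<Rightarrow> nat) \<Rightarrow> rat"
  where "block_form P s t = (let Bs = (SOME Bs. distinct Bs \<and> set Bs = P) in indicator_det Bs s * indicator_det Bs t)"

lemma block_form_set:
  assumes "distinct Bs"
  shows "block_form (set Bs) s t = indicator_det Bs s * indicator_det Bs t"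
proof -
  define Cs where "Cs = (SOME Cs. distinct Cs \<and> set Cs = set Bs)"
  have "distinct Cs \<and> set Cs = set Bs"
    unfolding Cs_def by (rule someI[of _ Bs]) (simp add: assms)
  then have "mset Cs = mset Bs" using assms by (metis set_eq_iff_mset_eq_distinct)
  then obtain p where p: "p permutes {..<length Bs}" "permute_list p Bs = Cs"
    using mset_eq_permutation by blast
  have "of_int (sign p) * of_int (sign p) = (1 :: rat)"
    by (simp add: sign_def)
  then show ?thesis
    unfolding block_form_def Let_def Cs_def[symmetric] p(2)[symmetric] indicator_det_permute_list[OF p(1)]
    by (metis (no_types, opaque_lifting) mult.assoc mult.left_commute mult_1)
qed

lemma block_form_image:
  assumes "bij w" "finite P"
  shows "block_form ((`) w ` P) s t = block_form P (inv' w \<circ> s) (inv' w \<circ> t)"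
proof -
  obtain Bs where Bs: "distinct Bs" "set Bs = P" using assms(2) finite_distinct_list by blast
  have "inj_on ((`) w) (set Bs)"
    using assms(1) by (meson bij_is_inj inj_image_eq_iff inj_onI)
  then have "distinct (map ((`) w) Bs)" using Bs by (simp add: distinct_map)
  from block_form_set[OF this, of s t] show ?thesis
    by (simp add: Bs(2) indicator_det_image[OF assms(1)] block_form_set[OF Bs(1), unfolded Bs(2)])
qed

text \<open>If both determinants were nonzero, the matchings behind them would make \<open>x\<close>
  a value of \<open>s\<close> and of \<open>t\<close>.\<close>

lemma indicator_det_singleton_zero:
  assumes "{x} \<in> set Bs" "\<And>i j. i < length Bs \<Longrightarrow> j < length Bs \<Longrightarrow> s i \<noteq> t j"
  shows "indicator_det Bs s * indicator_det Bs t = 0"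
proof (rule ccontr)
  assume a: "indicator_det Bs s * indicator_det Bs t \<noteq> 0"
  obtain j where j: "j < length Bs" "Bs ! j = {x}" using assms(1) by (meson in_set_conv_nth)
  obtain \<sigma> where "\<sigma> permutes {..<length Bs}" "s (\<sigma> j) = x"
    using a j indicator_det_nonzeroE[of Bs s] by (metis mult_eq_0_iff singletonD)
  moreover obtain \<sigma>' where "\<sigma>' permutes {..<length Bs}" "t (\<sigma>' j) = x"
    using a j indicator_det_nonzeroE[of Bs t] by (metis mult_eq_0_iff singletonD)
  ultimately show False using assms(2) j
    by (metis lessThan_iff permutes_in_image)
qed

text \<open>
  Expanding bilinearly, both sides are quadratic polynomials in the values of an alternating form
  on the six pairs from \<open>p, q, a, b\<close>. Below \<open>p = {i}\<close> and \<open>q = {i + 1}\<close>, and the right-hand side vanishes.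
\<close>

lemma seven_term_identity:
  fixes p q a b :: "nat set" and Bs :: "nat set list" and s t :: "nat \<Rightarrow> nat"
  assumes disj: "p \<inter> q = {}" "p \<inter> a = {}" "p \<inter> b = {}" "q \<inter> a = {}" "q \<inter> b = {}" "a \<inter> b = {}"
  defines "F \<equiv> \<lambda>X Y. indicator_det (X # Y # Bs) s * indicator_det (X # Y # Bs) t"
  shows "F (p \<union> a) (q \<union> b) + F (q \<union> a) (p \<union> b) + F (p \<union> q) (a \<union> b) - F (p \<union> q \<union> a) b - F (p \<union> q \<union> b) a
    = F p (q \<union> a \<union> b) + F q (p \<union> a \<union> b)"
proof -
  have d: "q \<inter> p = {}" "(p \<union> q) \<inter> a = {}" "(p \<union> q) \<inter> b = {}" "(q \<union> a) \<inter> b = {}" "(p \<union> a) \<inter> b = {}"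
    using disj by auto
  \<comment> \<open>Each of the six pairs gets one orientation, which leaves six unknowns for
    \<open>s\<close> and six for \<open>t\<close>.\<close>
  note sw = indicator_det_swap[of q p] indicator_det_swap[of a p] indicator_det_swap[of a q]
     indicator_det_swap[of b p] indicator_det_swap[of b q] indicator_det_swap[of b a]
  show ?thesis unfolding F_def
    by (simp only: indicator_det_Un_left indicator_det_Un_right disj d sw indicator_det_same)
       (simp add: algebra_simps)
qed

section \<open>The functions attached to set partitions\<close>

text \<open>Only these blocks enter the forms: moving a singleton must produce no sign, and a
  singleton column would make the product of the determinants vanish.\<close>

definition nonsingletons :: "nat set set \<Rightarrow> nat set set"
  where "nonsingletons \<pi> = {B \<in> \<pi>. card B \<noteq> 1}"

definition singletons :: "nat set set \<Rightarrow> nat set set"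
  where "singletons \<pi> = {B \<in> \<pi>. card B = 1}"

definition vandermonde :: "(nat \<Rightarrow> rat) \<Rightarrow> nat set \<Rightarrow> rat"
  where "vandermonde u D = (\<Prod>(a, b)\<in>{(a, b)\<in>D \<times> D. a < b}. u b - u a)"

lemma adj_transp_involutive [simp]: "adj_transp i (adj_transp i x) = x"
  by (simp add: adj_transp_def)

lemma bij_adj_transp: "bij (adj_transp i)"
  by (rule involuntory_imp_bij) simp

lemma inv_adj_transp [simp]: "inv' (adj_transp i) = adj_transp i"
  by (rule inv_unique_comp) (auto simp: fun_eq_iff)

lemma adj_transp_image_involutive [simp]: "adj_transp i ` adj_transp i ` D = D"
  by (simp add: image_image)

text \<open>An adjacent transposition keeps the order of every pair except
  \<open>(i, i + 1)\<close>. Hence all factors in \<open>Q\<close> are merely permuted, and the sign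
  comes from the factor \<open>c\<close>, present when both points lie in \<open>D\<close>.\<close>

lemma vandermonde_adj_transp:
  assumes "finite D"
  shows "vandermonde (u \<circ> adj_transp i) (adj_transp i ` D) =
    (if i \<in> D \<and> i + 1 \<in> D then - vandermonde u D else vandermonde u D)"
proof -
  let ?s = "adj_transp i"
  define Q where "Q E = {(a, b)\<in>E \<times> E. a < b \<and> (a, b) \<noteq> (i, i + 1)}" for E
  define c where "c E v = (if i \<in> E \<and> i + 1 \<in> E then v (i + 1) - v i else 1)" for E :: "nat set" and v :: "nat \<Rightarrow> rat"
  have fQ: "finite (Q E)" if "finite E" for E
    by (rule finite_subset[of _ "E \<times> E"]) (use that in \<open>auto simp: Q_def\<close>)
  have split: "vandermonde v E = c E v * (\<Prod>(a, b)\<in>Q E. v b - v a)" if "finite E" for E v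
  proof (cases "i \<in> E \<and> i + 1 \<in> E")
    case True
    then have "{(a, b)\<in>E \<times> E. a < b} = insert (i, i + 1) (Q E)" by (auto simp: Q_def)
    moreover have "(i, i + 1) \<notin> Q E" by (auto simp: Q_def)
    ultimately show ?thesis using True fQ[OF that] by (simp add: vandermonde_def c_def)
  next
    case False
    then have "{(a, b)\<in>E \<times> E. a < b} = Q E" by (auto simp: Q_def)
    with False show ?thesis by (auto simp add: vandermonde_def c_def)
  qed
  have "(\<Prod>(a, b)\<in>Q (?s ` D). (u \<circ> ?s) b - (u \<circ> ?s) a) = (\<Prod>(a, b)\<in>Q D. u b - u a)"
    by (rule prod.reindex_bij_witness[of _ "\<lambda>(a, b). (?s a, ?s b)" "\<lambda>(a, b). (?s a, ?s b)"])
       (auto simp: Q_def adj_transp_def transpose_def split: if_splits)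
  moreover have "i \<in> ?s ` D \<longleftrightarrow> i + 1 \<in> D" "i + 1 \<in> ?s ` D \<longleftrightarrow> i \<in> D"
    by (auto simp: adj_transp_def transpose_def image_iff split: if_splits)
  then have "c (?s ` D) (u \<circ> ?s) = (if i \<in> D \<and> i + 1 \<in> D then - c D u else c D u)"
    by (auto simp: c_def adj_transp_def transpose_def)
  ultimately show ?thesis using assms by (simp add: split)
qed

section \<open>Partition forms as functions on probes, and the action on probes\<close>

type_synonym probe = "(nat \<Rightarrow> rat) \<times> nat set \<times> nat \<times> (nat \<Rightarrow> nat) \<times> (nat \<Rightarrow> nat)"

text \<open>Since \<open>D\<close> and \<open>k\<close> belong to the probe, forms of partitions
  with different unions or numbers of nonsingleton blocks live on disjoint sets of probes. The bound
  \<open>k\<close> restricts the comparison of \<open>s\<close> and \<open>t\<close> to the entries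
  that the determinants use.\<close>

fun partition_form :: "nat set set \<Rightarrow> probe \<Rightarrow> rat"
  where "partition_form \<pi> (u, D, k, s, t) =
    (if D = \<Union>(nonsingletons \<pi>) \<and> k = card (nonsingletons \<pi>) \<and> (\<forall>i<k. \<forall>j<k. s i \<noteq> t j)
     then vandermonde u D * block_form (nonsingletons \<pi>) s t else 0)"

text \<open>Points move by the inverse of \<open>w\<close> and weights are pulled back along
  \<open>w\<close>. This is a right action on probes, so precomposition with it is a left action on
  functions.\<close>

fun act :: "(nat \<Rightarrow> nat) \<Rightarrow> probe \<Rightarrow> probe"
  where "act w (u, D, k, s, t) = (u \<circ> w, inv' w ` D, k, inv' w \<circ> s, inv' w \<circ> t)"

lemma act_comp:
  assumes "bij v" "bij w"
  shows "act w (act v p) = act (v \<circ> w) p"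
  by (cases p) (simp add: o_inv_distrib[OF assms] image_comp comp_assoc)

lemma act_id: "act id p = p"
  by (cases p) simp

lemma inj_image_bij: "bij w \<Longrightarrow> inj ((`) w)"
  by (meson bij_is_inj inj_image_eq_iff injI)

lemma nonsingletons_perm_partition:
  assumes "bij w"
  shows "nonsingletons (perm_partition w \<pi>) = (`) w ` nonsingletons \<pi>"
  using bij_is_inj[OF assms]
  by (auto simp: nonsingletons_def perm_partition_def card_image inj_on_subset)

lemma singletons_perm_partition:
  assumes "bij w"
  shows "singletons (perm_partition w \<pi>) = (`) w ` singletons \<pi>"
  using bij_is_inj[OF assms]
  by (auto simp: singletons_def perm_partition_def card_image inj_on_subset)

text \<open>The determinants are carried over without a sign, so the only sign is that of the
  Vandermonde product.\<close>

lemma partition_form_adj_transp: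
  assumes "finite \<pi>" "finite (\<Union>\<pi>)"
  shows "partition_form \<pi> (act (adj_transp i) p) =
    (if i \<in> \<Union>(nonsingletons \<pi>) \<and> i + 1 \<in> \<Union>(nonsingletons \<pi>) then -1 else 1) *
      partition_form (perm_partition (adj_transp i) \<pi>) p"
proof -
  obtain u D k s t where p: "p = (u, D, k, s, t)" by (cases p)
  let ?s = "adj_transp i" and ?N = "nonsingletons \<pi>"
  have fin: "finite ?N" "finite (\<Union>?N)"
    using assms by (auto simp: nonsingletons_def intro: rev_finite_subset)
  have U: "\<Union>(nonsingletons (perm_partition ?s \<pi>)) = ?s ` \<Union>?N"
    by (auto simp: nonsingletons_perm_partition[OF bij_adj_transp])
  have c: "card (nonsingletons (perm_partition ?s \<pi>)) = card ?N"
    unfolding nonsingletons_perm_partition[OF bij_adj_transp]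
    by (intro card_image) (meson inj_image_bij[OF bij_adj_transp] inj_on_subset subset_UNIV)
  have b: "block_form (nonsingletons (perm_partition ?s \<pi>)) s t = block_form ?N (?s \<circ> s) (?s \<circ> t)"
    unfolding nonsingletons_perm_partition[OF bij_adj_transp] block_form_image[OF bij_adj_transp fin(1)] by simp
  have D: "?s ` D = \<Union>?N \<longleftrightarrow> D = ?s ` \<Union>?N"
    by (metis adj_transp_image_involutive)
  have neq: "?s (s i') = ?s (t j) \<longleftrightarrow> s i' = t j" for i' j
    by (metis adj_transp_involutive)
  have mem: "i \<in> ?s ` E \<longleftrightarrow> i + 1 \<in> E" "i + 1 \<in> ?s ` E \<longleftrightarrow> i \<in> E" for E
    by (auto simp: adj_transp_def transpose_def image_iff split: if_splits)
  show ?thesis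
  proof (cases "D = ?s ` \<Union>?N")
    case True
    define E where "E = \<Union>?N"
    have E: "?s ` D = E" "finite D" using True fin by (simp_all add: E_def)
    have "i \<in> D \<longleftrightarrow> i + 1 \<in> E" "i + 1 \<in> D \<longleftrightarrow> i \<in> E"
      unfolding True E_def by (rule mem)+
    then have "vandermonde (u \<circ> ?s) E = (if i \<in> E \<and> i + 1 \<in> E then - vandermonde u D else vandermonde u D)"
      using vandermonde_adj_transp[OF E(2), of u i] E(1) by auto
    moreover have "\<Union>(nonsingletons (perm_partition ?s \<pi>)) = D" using U True by simp
    ultimately show ?thesis
      unfolding p act.simps partition_form.simps inv_adj_transp c b E(1) E_def[symmetric]
      by (cases "k = card ?N \<and> (\<forall>i<k. \<forall>j<k. s i \<noteq> t j)") (auto simp: neq)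
  next
    case False
    then show ?thesis by (simp add: p U D)
  qed
qed

section \<open>The skein relation for two blocks at adjacent points\<close>

lemma block_of_eq:
  assumes "partition_on S \<pi>" "X \<in> \<pi>" "x \<in> X"
  shows "block_of \<pi> x = X"
  unfolding block_of_def
proof (rule the_equality)
  show "X' = X" if "X' \<in> \<pi> \<and> x \<in> X'" for X'
    using partition_onD2[OF assms(1)] assms(2,3) that by (meson disjointD disjoint_iff)
qed (use assms in simp)

text \<open>\<open>R\<close> holds the blocks that stay fixed; the five partitions of the skein
  relation differ only in how they split the other points into two blocks. Noncrossing is not among
  the assumptions, so that the crossing partition is covered as well.\<close>

locale adjacent_blocks =
  fixes i :: nat and R :: "nat set set" and A B :: "nat set"
  assumes disjoint_R: "disjoint R" and empty_R: "{} \<notin> R"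
    and finite_R: "finite R"
    and finite_AB: "finite A" "finite B"
    and new_blocks: "\<Union>R \<inter> ({i, Suc i} \<union> A \<union> B) = {}"
    and disjoint_AB: "A \<inter> B = {}"
    and fresh: "i \<notin> A" "Suc i \<notin> A" "i \<notin> B" "Suc i \<notin> B"
    and nonempty: "A \<noteq> {}" "B \<noteq> {}"
begin

definition W :: "nat set"
  where "W = {i, Suc i} \<union> A \<union> B"

definition splits :: "nat set \<Rightarrow> nat set \<Rightarrow> bool"
  where "splits X Y \<longleftrightarrow> X \<union> Y = W \<and> X \<inter> Y = {} \<and> X \<noteq> {} \<and> Y \<noteq> {}"

lemma splits_simps [simp]:
  "splits (insert i A) (insert (Suc i) B)"
  "splits (insert (Suc i) A) (insert i B)"
  "splits {i, Suc i} (A \<union> B)"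
  "splits ({i, Suc i} \<union> A) B"
  "splits ({i, Suc i} \<union> B) A"
  using disjoint_AB fresh nonempty by (auto simp: splits_def W_def)

lemma splits_notin:
  assumes "splits X Y"
  shows "X \<notin> R" "Y \<notin> R" "X \<noteq> Y" "finite X" "finite Y"
proof -
  show "X \<notin> R" "Y \<notin> R" using assms new_blocks unfolding splits_def W_def by blast+
  show "X \<noteq> Y" using assms unfolding splits_def by blast
  have "finite W" using finite_AB by (simp add: W_def)
  then show "finite X" "finite Y" using assms unfolding splits_def by (metis finite_Un)+
qed

lemma splits_partition_on:
  assumes "splits X Y"
  shows "partition_on (\<Union>R \<union> W) (insert X (insert Y R))"
proof (rule partition_onI)
  have "disjnt X Y" "\<And>Z. Z \<in> R \<Longrightarrow> disjnt X Z" "\<And>Z. Z \<in> R \<Longrightarrow> disjnt Y Z"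
    using assms new_blocks unfolding splits_def W_def disjnt_def by blast+
  moreover have "\<And>Z Z'. Z \<in> R \<Longrightarrow> Z' \<in> R \<Longrightarrow> Z \<noteq> Z' \<Longrightarrow> disjnt Z Z'"
    using disjoint_R by (auto simp: disjoint_def disjnt_def)
  ultimately show "\<And>p q. p \<in> insert X (insert Y R) \<Longrightarrow> q \<in> insert X (insert Y R) \<Longrightarrow> p \<noteq> q \<Longrightarrow> disjnt p q"
    by (metis disjnt_sym insertE)
  show "\<Union>(insert X (insert Y R)) = \<Union>R \<union> W" using assms unfolding splits_def by blast
  show "{} \<notin> insert X (insert Y R)" using assms empty_R unfolding splits_def by blast
qed

lemma splits_card:
  assumes "splits X Y"
  shows "card (insert X (insert Y R)) = card R + 2"
  using splits_notin[OF assms] finite_R by simp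

lemma splits_singletons:
  assumes "splits X Y"
  shows "card (singletons (insert X (insert Y R))) =
    card (singletons R) + of_bool (card X = 1) + of_bool (card Y = 1)"
proof -
  have "singletons (insert X (insert Y R)) =
     (if card X = 1 then {X} else {}) \<union> (if card Y = 1 then {Y} else {}) \<union> singletons R"
    by (auto simp: singletons_def)
  moreover have "X \<notin> singletons R" "Y \<notin> singletons R" "X \<noteq> Y" "finite (singletons R)"
    using splits_notin[OF assms] finite_R by (auto simp: singletons_def)
  ultimately show ?thesis by auto
qed

text \<open>The form of \<open>insert X (insert Y R)\<close>, except that \<open>X\<close> and
  \<open>Y\<close> are columns even when they are singletons. The conditions on \<open>D\<close> and
  \<open>k\<close> are then the same for every split of \<open>W\<close>, so the skein relation can
  be proved without cases on the sizes of \<open>A\<close> and \<open>B\<close>.\<close>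

definition pair_term :: "nat set \<Rightarrow> nat set \<Rightarrow> probe \<Rightarrow> rat"
  where "pair_term X Y = (\<lambda>(u, D, k, s, t).
    let Bs = X # Y # (SOME Bs. distinct Bs \<and> set Bs = nonsingletons R) in
    if D = \<Union>(nonsingletons R) \<union> W \<and> k = length Bs \<and> (\<forall>i<k. \<forall>j<k. s i \<noteq> t j)
    then vandermonde u D * (indicator_det Bs s * indicator_det Bs t) else 0)"

lemma partition_form_pair:
  assumes "splits X Y" "card X \<noteq> 1" "card Y \<noteq> 1"
  shows "partition_form (insert X (insert Y R)) p = pair_term X Y p"
proof -
  obtain u D k s t where p: "p = (u, D, k, s, t)" by (cases p)
  define Bs where "Bs = (SOME Bs. distinct Bs \<and> set Bs = nonsingletons R)"
  have fin: "finite (nonsingletons R)" using finite_R by (simp add: nonsingletons_def)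
  have Bs: "distinct Bs \<and> set Bs = nonsingletons R"
    unfolding Bs_def by (rule someI_ex) (metis fin finite_distinct_list)
  have N: "nonsingletons (insert X (insert Y R)) = set (X # Y # Bs)"
    using assms Bs by (auto simp: nonsingletons_def)
  have d: "distinct (X # Y # Bs)"
    using splits_notin[OF assms(1)] Bs by (auto simp: nonsingletons_def)
  have U: "\<Union>(set (X # Y # Bs)) = \<Union>(nonsingletons R) \<union> W"
    using assms(1) Bs by (auto simp: splits_def)
  show ?thesis
    unfolding p partition_form.simps N block_form_set[OF d] U distinct_card[OF d]
    by (cases "D = \<Union>(nonsingletons R) \<union> W \<and> k = length (X # Y # Bs)")
      (auto simp: pair_term_def Let_def Bs_def)
qed

text \<open>Counterpart of the rule that deletes a skein term in which \<open>A\<close> or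
  \<open>B\<close> would become a singleton block.\<close>

lemma pair_term_singleton:
  assumes "card X = 1 \<or> card Y = 1"
  shows "pair_term X Y p = 0"
proof -
  obtain x where "X = {x} \<or> Y = {x}" using assms by (metis card_1_singletonE)
  then show ?thesis
    using indicator_det_singleton_zero[of x "X # Y # (SOME Bs. distinct Bs \<and> set Bs = nonsingletons R)"]
    by (cases p) (auto simp: pair_term_def Let_def)
qed

text \<open>This is \<open>seven_term_identity\<close> for \<open>{i}\<close>,
  \<open>{Suc i}\<close>, \<open>A\<close>, \<open>B\<close>: its right-hand side consists of
  products with a singleton column, which vanish.\<close>

lemma pair_term_relation:
  "pair_term (insert i A) (insert (Suc i) B) p + pair_term (insert (Suc i) A) (insert i B) p
    + pair_term {i, Suc i} (A \<union> B) p - pair_term ({i, Suc i} \<union> A) B p - pair_term ({i, Suc i} \<union> B) A p = 0"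
proof -
  obtain u D k s t where p: "p = (u, D, k, s, t)" by (cases p)
  let ?F = "\<lambda>X Y. indicator_det (X # Y # (SOME Bs. distinct Bs \<and> set Bs = nonsingletons R)) s *
      indicator_det (X # Y # (SOME Bs. distinct Bs \<and> set Bs = nonsingletons R)) t"
  have "{i} \<inter> {Suc i} = {}" "{i} \<inter> A = {}" "{i} \<inter> B = {}" "{Suc i} \<inter> A = {}" "{Suc i} \<inter> B = {}"
    using fresh by auto
  note seven = seven_term_identity[OF this disjoint_AB, of "SOME Bs. distinct Bs \<and> set Bs = nonsingletons R" s t]
  have z: "pair_term {i} ({Suc i} \<union> A \<union> B) p = 0" "pair_term {Suc i} ({i} \<union> A \<union> B) p = 0"
    by (auto intro: pair_term_singleton)
  define C where "C \<longleftrightarrow> D = \<Union>(nonsingletons R) \<union> W \<and>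
    k = Suc (Suc (length (SOME Bs. distinct Bs \<and> set Bs = nonsingletons R))) \<and> (\<forall>i<k. \<forall>j<k. s i \<noteq> t j)"
  have pt: "pair_term X Y p = (if C then vandermonde u D * ?F X Y else 0)" for X Y
    unfolding p pair_term_def C_def by (simp add: Let_def)
  show ?thesis
  \<comment> \<open>A nonzero Vandermonde factor can be cancelled, which turns the vanishing of the
    two singleton terms into that of the determinant products. Otherwise every term is zero.\<close>
  proof (cases "C \<and> vandermonde u D \<noteq> 0")
    case True
    then have "?F {i} ({Suc i} \<union> A \<union> B) = 0" "?F {Suc i} ({i} \<union> A \<union> B) = 0"
      using z by (simp_all add: pt)
    with seven have "?F ({i} \<union> A) ({Suc i} \<union> B) + ?F ({Suc i} \<union> A) ({i} \<union> B)
      + ?F ({i} \<union> {Suc i}) (A \<union> B) - ?F ({i} \<union> {Suc i} \<union> A) B - ?F ({i} \<union> {Suc i} \<union> B) A = 0"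
      by linarith
    then have "vandermonde u D * (?F ({i} \<union> A) ({Suc i} \<union> B) + ?F ({Suc i} \<union> A) ({i} \<union> B)
      + ?F ({i} \<union> {Suc i}) (A \<union> B) - ?F ({i} \<union> {Suc i} \<union> A) B - ?F ({i} \<union> {Suc i} \<union> B) A) = 0"
      by simp
    then show ?thesis using True by (simp add: pt algebra_simps insert_commute[of "Suc i" i])
  next
    case False
    then show ?thesis by (auto simp add: pt)
  qed
qed

lemma card_ne_1 [simp]:
  "card (insert i A) \<noteq> Suc 0" "card (insert (Suc i) A) \<noteq> Suc 0"
  "card (insert i B) \<noteq> Suc 0" "card (insert (Suc i) B) \<noteq> Suc 0"
  "card (A \<union> B) \<noteq> Suc 0" "card (insert i (insert (Suc i) A)) \<noteq> Suc 0" "card (insert i (insert (Suc i) B)) \<noteq> Suc 0"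
  using fresh nonempty finite_AB disjoint_AB
  by (auto simp: card_Un_disjoint card_eq_0_iff add_is_1)

text \<open>The first summand is the form of the partition to which \<open>skein\<close> is applied,
  and the others are the form of its resolution. So resolving reverses the sign of the form; the
  Vandermonde sign compensates for this.\<close>

lemma partition_form_relation:
  "partition_form (insert (insert i A) (insert (insert (Suc i) B) R)) p
    + partition_form (insert (insert (Suc i) A) (insert (insert i B) R)) p
    + partition_form (insert {i, Suc i} (insert (A \<union> B) R)) p
    - (if card B = 1 then 0 else partition_form (insert ({i, Suc i} \<union> A) (insert B R)) p)
    - (if card A = 1 then 0 else partition_form (insert ({i, Suc i} \<union> B) (insert A R)) p) = 0"
proof -
  have "(if card B = 1 then 0 else partition_form (insert ({i, Suc i} \<union> A) (insert B R)) p)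
      = pair_term ({i, Suc i} \<union> A) B p"
    using pair_term_singleton[of "{i, Suc i} \<union> A" B p] partition_form_pair[of "{i, Suc i} \<union> A" B p] splits_simps
    by (simp del: splits_simps)
  moreover have "(if card A = 1 then 0 else partition_form (insert ({i, Suc i} \<union> B) (insert A R)) p)
      = pair_term ({i, Suc i} \<union> B) A p"
    using pair_term_singleton[of "{i, Suc i} \<union> B" A p] partition_form_pair[of "{i, Suc i} \<union> B" A p] splits_simps
    by (simp del: splits_simps)
  ultimately show ?thesis using pair_term_relation[of p]
    by (simp add: partition_form_pair)
qed

lemma block_of_pair:
  assumes "splits X Y"
  shows "x \<in> X \<Longrightarrow> block_of (insert X (insert Y R)) x = X"
    "x \<in> Y \<Longrightarrow> block_of (insert X (insert Y R)) x = Y"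
  using block_of_eq[OF splits_partition_on[OF assms]] by simp_all

lemma adj_transp_image:
  "adj_transp i ` insert i A = insert (Suc i) A" "adj_transp i ` insert (Suc i) A = insert i A"
  "adj_transp i ` insert i B = insert (Suc i) B" "adj_transp i ` insert (Suc i) B = insert i B"
proof -
  have "adj_transp i ` X = X" if "i \<notin> X" "Suc i \<notin> X" for X
    using that by (force simp: adj_transp_def transpose_def image_iff)
  then show "adj_transp i ` insert i A = insert (Suc i) A" "adj_transp i ` insert (Suc i) A = insert i A"
    "adj_transp i ` insert i B = insert (Suc i) B" "adj_transp i ` insert (Suc i) B = insert i B"
    using fresh by (simp_all add: adj_transp_def)
qed

lemma perm_partition_pair:
  "perm_partition (adj_transp i) (insert X (insert Y R)) =
    insert (adj_transp i ` X) (insert (adj_transp i ` Y) R)"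
proof -
  have "adj_transp i ` X = X" if "X \<in> R" for X
    using that new_blocks by (force simp: adj_transp_def transpose_def image_iff)
  then show ?thesis by (simp add: perm_partition_def)
qed

lemma skein_pair:
  "skein i (insert (insert i A) (insert (insert (Suc i) B) R)) =
    basis_vec (insert (insert (Suc i) A) (insert (insert i B) R))
    + basis_vec (insert {i, Suc i} (insert (A \<union> B) R))
    - (if card B = 1 then 0 else basis_vec (insert ({i, Suc i} \<union> A) (insert B R)))
    - (if card A = 1 then 0 else basis_vec (insert ({i, Suc i} \<union> B) (insert A R)))"
proof -
  let ?p = "insert (insert i A) (insert (insert (Suc i) B) R)"
  have "block_of ?p i = insert i A" "block_of ?p (Suc i) = insert (Suc i) B"
    by (rule block_of_pair; simp)+
  moreover have "insert i A - {i} = A" "insert (Suc i) B - {Suc i} = B" using fresh by auto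
  moreover have "?p - {insert i A, insert (Suc i) B} = R"
    using splits_notin[OF splits_simps(1)] by auto
  ultimately show ?thesis
    unfolding skein_def Let_def
    by (simp add: perm_partition_pair adj_transp_image insert_commute[of "insert i B"] del: image_insert)
qed

end

section \<open>Noncrossing partitions\<close>

text \<open>On a circle: the chord from \<open>y\<close> to \<open>w\<close> separates two points of \<open>X\<close>.\<close>

definition separates :: "nat \<Rightarrow> nat \<Rightarrow> nat set \<Rightarrow> bool"
  where "separates y w X \<longleftrightarrow> (\<exists>x\<in>X. \<exists>x'\<in>X. y < x \<and> x < w \<and> (x' < y \<or> w < x'))"

text \<open>Formulated with chords of \<open>Y\<close> because these stay fixed while points are
  added to \<open>X\<close>; the symmetry of the relation is \<open>uncrossed_sym\<close>.\<close>

definition uncrossed :: "nat set \<Rightarrow> nat set \<Rightarrow> bool"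
  where "uncrossed X Y \<longleftrightarrow> (\<forall>y\<in>Y. \<forall>w\<in>Y. \<not> separates y w X)"

lemma uncrossed_iff:
  "uncrossed X Y \<longleftrightarrow> \<not> (\<exists>a b c d. a < b \<and> b < c \<and> c < d \<and>
    (a \<in> X \<and> c \<in> X \<and> b \<in> Y \<and> d \<in> Y \<or> a \<in> Y \<and> c \<in> Y \<and> b \<in> X \<and> d \<in> X))"
  unfolding uncrossed_def separates_def by blast

lemma uncrossed_sym: "uncrossed X Y \<longleftrightarrow> uncrossed Y X"
  unfolding uncrossed_iff by blast

lemma uncrossed_mono: "uncrossed X Y \<Longrightarrow> X' \<subseteq> X \<Longrightarrow> Y' \<subseteq> Y \<Longrightarrow> uncrossed X' Y'"
  unfolding uncrossed_def separates_def by blast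

lemma noncrossing_iff: "noncrossing \<pi> \<longleftrightarrow> (\<forall>X\<in>\<pi>. \<forall>Y\<in>\<pi>. X \<noteq> Y \<longrightarrow> uncrossed X Y)"
proof
  assume n: "noncrossing \<pi>"
  have "A = B" if "A \<in> \<pi>" "B \<in> \<pi>" "a < b" "b < c" "c < d" "a \<in> A" "c \<in> A" "b \<in> B" "d \<in> B" for A B a b c d
    using n that unfolding noncrossing_def by blast
  then have "uncrossed X Y" if "X \<in> \<pi>" "Y \<in> \<pi>" "X \<noteq> Y" for X Y
    unfolding uncrossed_iff using that by blast
  then show "\<forall>X\<in>\<pi>. \<forall>Y\<in>\<pi>. X \<noteq> Y \<longrightarrow> uncrossed X Y" by blast
next
  assume "\<forall>X\<in>\<pi>. \<forall>Y\<in>\<pi>. X \<noteq> Y \<longrightarrow> uncrossed X Y"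
  then have u: "uncrossed X Y" if "X \<in> \<pi>" "Y \<in> \<pi>" "X \<noteq> Y" for X Y
    using that by blast
  show "noncrossing \<pi>" unfolding noncrossing_def
  proof (intro allI ballI impI)
    fix a b c d A B
    assume h: "A \<in> \<pi>" "B \<in> \<pi>" "a < b \<and> b < c \<and> c < d \<and> a \<in> A \<and> c \<in> A \<and> b \<in> B \<and> d \<in> B"
    have "\<not> uncrossed A B" unfolding uncrossed_iff using h(3) by blast
    then show "A = B" using u h by blast
  qed
qed

lemma noncrossing_insert:
  assumes "X \<notin> \<pi>"
  shows "noncrossing (insert X \<pi>) \<longleftrightarrow> (\<forall>Z\<in>\<pi>. uncrossed X Z) \<and> noncrossing \<pi>"
proof
  assume "noncrossing (insert X \<pi>)"
  then show "(\<forall>Z\<in>\<pi>. uncrossed X Z) \<and> noncrossing \<pi>"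
    unfolding noncrossing_iff using assms by (metis insertCI)
next
  assume h: "(\<forall>Z\<in>\<pi>. uncrossed X Z) \<and> noncrossing \<pi>"
  then have "\<And>Z. Z \<in> \<pi> \<Longrightarrow> uncrossed Z X" using uncrossed_sym by blast
  with h show "noncrossing (insert X \<pi>)" unfolding noncrossing_iff by blast
qed

lemma uncrossed_singleton: "uncrossed {x} Y"
  by (auto simp: uncrossed_def separates_def)

text \<open>A chord of \<open>Z\<close> ends at neither \<open>i\<close> nor \<open>Suc i\<close>,
  so both lie on the same side of it. Each of the two given sets contains one of them and is not
  separated, hence neither is their union.\<close>

lemma uncrossed_merge:
  assumes "uncrossed (insert (Suc i) A) Z" "uncrossed (insert i B) Z" "i \<notin> Z" "Suc i \<notin> Z"
  shows "uncrossed ({i, Suc i} \<union> (A \<union> B)) Z"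
  unfolding uncrossed_def
proof (intro ballI notI)
  fix y w assume yw: "y \<in> Z" "w \<in> Z" and sep: "separates y w ({i, Suc i} \<union> (A \<union> B))"
  have i: "y < Suc i \<longleftrightarrow> y < i" "Suc i < w \<longleftrightarrow> i < w" "y \<noteq> i" "w \<noteq> i" "y \<noteq> Suc i" "w \<noteq> Suc i"
    using assms(3,4) yw by (metis Suc_lessI less_SucE less_SucI Suc_lessD)+
  have n: "\<not> separates y w (insert (Suc i) A)" "\<not> separates y w (insert i B)"
    using assms(1,2) yw by (auto simp: uncrossed_def)
  obtain x x' where x: "x \<in> {i, Suc i} \<union> (A \<union> B)" "x' \<in> {i, Suc i} \<union> (A \<union> B)" "y < x" "x < w" "x' < y \<or> w < x'"
    using sep unfolding separates_def by auto
  show False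
  proof (cases "y < i \<and> i < w")
    case True
    then have "y < Suc i \<and> Suc i < w" using i by auto
    with True x n show False unfolding separates_def by auto
  next
    case False
    then have "i < y \<or> w < i" "Suc i < y \<or> w < Suc i" using i by auto
    with False x n i show False unfolding separates_def by auto
  qed
qed

text \<open>No chord of \<open>Z\<close> separates \<open>i\<close> from \<open>Suc i\<close>, so
  either of them may be added wherever the other is present.\<close>

lemma uncrossed_insert_adjacent:
  assumes "uncrossed (insert (Suc i) A) Z \<or> uncrossed (insert i A) Z" "i \<notin> Z" "Suc i \<notin> Z"
  shows "uncrossed ({i, Suc i} \<union> A) Z"
  unfolding uncrossed_def
proof (intro ballI notI)
  fix y w assume yw: "y \<in> Z" "w \<in> Z" and sep: "separates y w ({i, Suc i} \<union> A)"
  have i: "y < Suc i \<longleftrightarrow> y < i" "Suc i < w \<longleftrightarrow> i < w" "y \<noteq> i" "w \<noteq> i" "y \<noteq> Suc i" "w \<noteq> Suc i"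
    using assms(2,3) yw by (metis Suc_lessI less_SucE less_SucI Suc_lessD)+
  have n: "\<not> separates y w (insert (Suc i) A) \<or> \<not> separates y w (insert i A)"
    using assms(1) yw by (auto simp: uncrossed_def)
  obtain x x' where x: "x \<in> {i, Suc i} \<union> A" "x' \<in> {i, Suc i} \<union> A" "y < x" "x < w" "x' < y \<or> w < x'"
    using sep unfolding separates_def by auto
  show False
  proof (cases "y < i \<and> i < w")
    case True
    then have "y < Suc i \<and> Suc i < w" using i by auto
    with True x n show False unfolding separates_def by auto
  next
    case False
    then have "i < y \<or> w < i" "Suc i < y \<or> w < Suc i" using i by auto
    with False x n i show False unfolding separates_def by auto
  qed
qed

text \<open>Of the two ways to join the neighbours \<open>i\<close>, \<open>Suc i\<close> to
  \<open>a\<close>, \<open>b\<close> by chords, one crosses. Therefore exchanging \<open>i\<close>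
  and \<open>Suc i\<close> between two nonsingleton blocks of a noncrossing partition always creates
  a crossing.\<close>

lemma crossed_swap:
  assumes "uncrossed (insert (Suc i) A) (insert i B)" "a \<in> A" "b \<in> B" "a \<noteq> b" "a \<notin> {i, Suc i}" "b \<notin> {i, Suc i}"
  shows "\<not> uncrossed (insert i A) (insert (Suc i) B)"
proof
  assume u: "uncrossed (insert i A) (insert (Suc i) B)"
  have d: "\<not> (x < y \<and> y < x' \<and> x' < y') \<and> \<not> (y < x \<and> x < y' \<and> y' < x')"
    if "uncrossed X Y" "x \<in> X" "x' \<in> X" "y \<in> Y" "y' \<in> Y" for X Y x x' y y'
    using that unfolding uncrossed_iff by blast
  have m: "Suc i \<in> insert (Suc i) A" "a \<in> insert (Suc i) A" "i \<in> insert i B" "b \<in> insert i B"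
    "i \<in> insert i A" "a \<in> insert i A" "Suc i \<in> insert (Suc i) B" "b \<in> insert (Suc i) B"
    using assms by auto
  \<comment> \<open>No point lies between \<open>i\<close> and \<open>Suc i\<close>, so six orders
    remain; they contradict \<open>u\<close> and the hypothesis alternately.\<close>
  consider "a < b \<and> b < i" | "b < a \<and> a < i" | "b < i \<and> Suc i < a" | "a < i \<and> Suc i < b"
    | "Suc i < a \<and> a < b" | "Suc i < b \<and> b < a"
    using assms(4,5,6) by (metis Suc_lessI insertCI linorder_neqE_nat)
  then show False
  proof cases
    case 1 with d[OF u m(6,5,8,7)] show False by linarith
  next
    case 2 with d[OF assms(1) m(2,1,4,3)] show False by linarith
  next
    case 3 with d[OF u m(5,6,8,7)] show False by linarith
  next
    case 4 with d[OF assms(1) m(2,1,3,4)] show False by linarith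
  next
    case 5 with d[OF u m(5,6,7,8)] show False by linarith
  next
    case 6 with d[OF assms(1) m(1,2,3,4)] show False by linarith
  qed
qed

text \<open>A crossing uses two points from each of two blocks, so the singleton is not involved.
  The two blocks then contain at most one of \<open>i\<close>, \<open>i + 1\<close>, and the
  transposition preserves the order on their union.\<close>

lemma noncrossing_adj_transp_singleton:
  assumes "noncrossing \<pi>" "partition_on S \<pi>" "{i} \<in> \<pi> \<or> {i + 1} \<in> \<pi>"
  shows "noncrossing (perm_partition (adj_transp i) \<pi>)"
proof -
  let ?s = "adj_transp i"
  have False if X: "X \<in> \<pi>" and Y: "Y \<in> \<pi>" and ne: "?s ` X \<noteq> ?s ` Y"
    and yw: "y \<in> ?s ` Y" "w \<in> ?s ` Y" and sep: "separates y w (?s ` X)" for X Y y w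
  proof -
  from sep obtain x x' where x: "x \<in> ?s ` X" "x' \<in> ?s ` X" "y < x" "x < w" "x' < y \<or> w < x'"
    unfolding separates_def by auto
  have "X \<noteq> Y" using ne by metis
  then have u: "uncrossed X Y" using assms(1) X Y unfolding noncrossing_iff by blast
  obtain x0 x0' y0 w0 where 0: "x0 \<in> X" "x0' \<in> X" "y0 \<in> Y" "w0 \<in> Y" "x = ?s x0" "x' = ?s x0'" "y = ?s y0" "w = ?s w0"
    using x yw by auto
  have "\<not> (i \<in> X \<union> Y \<and> Suc i \<in> X \<union> Y)"
  proof
    assume b: "i \<in> X \<union> Y \<and> Suc i \<in> X \<union> Y"
    have "X = {i} \<or> Y = {i} \<or> X = {Suc i} \<or> Y = {Suc i}"
      using assms(2,3) X Y b block_of_eq by (metis Suc_eq_plus1 Un_iff singletonI)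
    then show False using x yw 0 by auto
  qed
  then have "?s a < ?s b \<Longrightarrow> a < b" if "a \<in> X \<union> Y" "b \<in> X \<union> Y" for a b
    using that by (auto simp: adj_transp_def transpose_def split: if_splits) 
  then have "y0 < x0 \<and> x0 < w0 \<and> (x0' < y0 \<or> w0 < x0')" using x 0 by (metis UnCI)
  then show False using u 0 unfolding uncrossed_def separates_def by blast
  qed
  then show ?thesis unfolding noncrossing_iff perm_partition_def uncrossed_def by blast
qed

context adjacent_blocks
begin

lemma noncrossing_pair:
  assumes "splits X Y"
  shows "noncrossing (insert X (insert Y R)) \<longleftrightarrow>
    uncrossed X Y \<and> (\<forall>Z\<in>R. uncrossed X Z \<and> uncrossed Y Z) \<and> noncrossing R"
  using splits_notin[OF assms] noncrossing_insert[of X "insert Y R"] noncrossing_insert[of Y R]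
  by auto

text \<open>Against \<open>R\<close>, the resolved blocks are controlled by merging the two old
  blocks; against each other, by the adjacency of \<open>i\<close> and \<open>Suc i\<close>.\<close>

lemma noncrossing_resolution:
  assumes "noncrossing (insert (insert (Suc i) A) (insert (insert i B) R))"
  shows "noncrossing (insert {i, Suc i} (insert (A \<union> B) R))"
    "noncrossing (insert ({i, Suc i} \<union> A) (insert B R))"
    "noncrossing (insert ({i, Suc i} \<union> B) (insert A R))"
    "\<not> noncrossing (insert (insert i A) (insert (insert (Suc i) B) R))"
proof -
  have h: "uncrossed (insert (Suc i) A) (insert i B)" "noncrossing R"
    "\<And>Z. Z \<in> R \<Longrightarrow> uncrossed (insert (Suc i) A) Z" "\<And>Z. Z \<in> R \<Longrightarrow> uncrossed (insert i B) Z"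
    using assms by (auto simp: noncrossing_pair)
  have out: "i \<notin> Z \<and> Suc i \<notin> Z" if "Z \<in> R" for Z
    using that new_blocks by auto
  have m: "uncrossed ({i, Suc i} \<union> (A \<union> B)) Z" if "Z \<in> R" for Z
    using uncrossed_merge h that out by blast
  \<comment> \<open>Every block of a resolution is contained in the merged set, so \<open>m\<close>
    settles all comparisons with \<open>R\<close> at once.\<close>
  have R': "Z \<in> R \<Longrightarrow> X \<subseteq> {i, Suc i} \<union> (A \<union> B) \<Longrightarrow> uncrossed X Z" for X Z
    using m uncrossed_mono by blast
  \<comment> \<open>The empty set in the role of \<open>A\<close> reduces the claim to a singleton,
    which is never crossed.\<close>
  have "uncrossed ({i, Suc i} \<union> {}) (A \<union> B)"
    by (rule uncrossed_insert_adjacent) (use fresh uncrossed_singleton in auto)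
  then have "uncrossed {i, Suc i} (A \<union> B)" by simp
  then show "noncrossing (insert {i, Suc i} (insert (A \<union> B) R))"
    unfolding noncrossing_pair[OF splits_simps(3)]
    using h(2) R'[of _ "{i, Suc i}"] R'[of _ "A \<union> B"] by blast
  have "uncrossed (insert (Suc i) A) B" using h(1) by (rule uncrossed_mono) auto
  then have "uncrossed ({i, Suc i} \<union> A) B" by (intro uncrossed_insert_adjacent) (use fresh in auto)
  then show "noncrossing (insert ({i, Suc i} \<union> A) (insert B R))"
    unfolding noncrossing_pair[OF splits_simps(4)]
    using h(2) R'[of _ "{i, Suc i} \<union> A"] R'[of _ "B"] by blast
  have "uncrossed (insert i B) A" by (rule uncrossed_mono[OF h(1)[unfolded uncrossed_sym[of "insert (Suc i) A"]]]) auto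
  then have "uncrossed ({i, Suc i} \<union> B) A" by (intro uncrossed_insert_adjacent) (use fresh in auto)
  then show "noncrossing (insert ({i, Suc i} \<union> B) (insert A R))"
    unfolding noncrossing_pair[OF splits_simps(5)]
    using h(2) R'[of _ "{i, Suc i} \<union> B"] R'[of _ "A"] by blast
  obtain a b where "a \<in> A" "b \<in> B" using nonempty by auto
  then have "\<not> uncrossed (insert i A) (insert (Suc i) B)"
    using crossed_swap[OF h(1)] fresh disjoint_AB by blast
  then show "\<not> noncrossing (insert (insert i A) (insert (insert (Suc i) B) R))"
    by (simp add: noncrossing_pair)
qed

end

section \<open>The operators on the noncrossing basis\<close>

definition int_span :: "'a set \<Rightarrow> ('a \<Rightarrow>\<^sub>0 rat) set"
  where "int_span X = {v \<in> qspace X. \<forall>x. Poly_Mapping.lookup v x \<in> \<int>}"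

lemma int_span_0 [intro]: "0 \<in> int_span X"
  by (simp add: int_span_def qspace_def)

lemma int_span_basis_vec [intro]: "x \<in> X \<Longrightarrow> basis_vec x \<in> int_span X"
  by (auto simp: int_span_def qspace_def basis_vec_def lookup_single when_def)

lemma qspace_iff: "v \<in> qspace X \<longleftrightarrow> (\<forall>x. x \<notin> X \<longrightarrow> Poly_Mapping.lookup v x = 0)"
  by (auto simp: qspace_def in_keys_iff subset_iff)

lemma int_span_add [intro]: "v \<in> int_span X \<Longrightarrow> w \<in> int_span X \<Longrightarrow> v + w \<in> int_span X"
  by (simp add: int_span_def qspace_iff lookup_add)

lemma int_span_diff [intro]: "v \<in> int_span X \<Longrightarrow> w \<in> int_span X \<Longrightarrow> v - w \<in> int_span X"
  by (simp add: int_span_def qspace_iff lookup_minus)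

lemma int_span_uminus [intro]: "v \<in> int_span X \<Longrightarrow> - v \<in> int_span X"
  by (simp add: int_span_def qspace_iff)

lemma int_span_qscale: "v \<in> int_span X \<Longrightarrow> c \<in> \<int> \<Longrightarrow> qscale c v \<in> int_span X"
  by (simp add: int_span_def qspace_iff lookup_qscale)

lemma int_span_sum: "(\<And>x. x \<in> I \<Longrightarrow> f x \<in> int_span X) \<Longrightarrow> sum f I \<in> int_span X"
  by (induction I rule: infinite_finite_induct) auto

lemma int_span_subset_qspace: "int_span X \<subseteq> qspace X"
  by (auto simp: int_span_def)

text \<open>Linear extension of \<open>partition_form\<close>; on \<open>qspace (NC n)\<close> it is
  the embedding into functions on probes.\<close>

definition form_sum :: "(nat set set \<Rightarrow>\<^sub>0 rat) \<Rightarrow> probe \<Rightarrow> rat"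
  where "form_sum v p = (\<Sum>\<pi>\<in>Poly_Mapping.keys v. Poly_Mapping.lookup v \<pi> * partition_form \<pi> p)"

lemma form_sum_superset:
  assumes "finite S" "Poly_Mapping.keys v \<subseteq> S"
  shows "form_sum v p = (\<Sum>\<pi>\<in>S. Poly_Mapping.lookup v \<pi> * partition_form \<pi> p)"
  unfolding form_sum_def using assms by (intro sum.mono_neutral_left) (auto simp: in_keys_iff)

lemma form_sum_add: "form_sum (v + w) p = form_sum v p + form_sum w p"
proof -
  let ?S = "Poly_Mapping.keys v \<union> Poly_Mapping.keys w"
  have "form_sum x p = (\<Sum>\<pi>\<in>?S. Poly_Mapping.lookup x \<pi> * partition_form \<pi> p)" if "x \<in> {v, w, v + w}" for x
    using that Poly_Mapping.keys_add[of v w] by (intro form_sum_superset) auto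
  then show ?thesis by (simp add: lookup_add distrib_right sum.distrib)
qed

lemma form_sum_qscale: "form_sum (qscale c v) p = c * form_sum v p"
proof -
  have "Poly_Mapping.keys (qscale c v) \<subseteq> Poly_Mapping.keys v"
    by (auto simp: in_keys_iff lookup_qscale)
  from form_sum_superset[OF _ this] show ?thesis
    by (simp add: form_sum_def sum_distrib_left lookup_qscale mult_ac)
qed

lemma form_sum_0: "form_sum 0 p = 0"
  by (simp add: form_sum_def)

lemma form_sum_uminus: "form_sum (- v) p = - form_sum v p"
  using form_sum_add[of v "- v" p] by (simp add: form_sum_0)

lemma form_sum_diff: "form_sum (v - w) p = form_sum v p - form_sum w p"
  using form_sum_add[of v "- w" p] by (simp add: form_sum_uminus)

lemma form_sum_sum: "form_sum (sum f I) p = (\<Sum>x\<in>I. form_sum (f x) p)"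
  by (induction I rule: infinite_finite_induct) (simp_all add: form_sum_0 form_sum_add)

lemma form_sum_basis_vec [simp]: "form_sum (basis_vec \<pi>) p = partition_form \<pi> p"
  by (simp add: form_sum_def basis_vec_def)

section \<open>One operator applied to one noncrossing partition\<close>

lemma NC_singletons_alt:
  "NC_singletons n k s = {\<pi> \<in> NC n. card \<pi> = k \<and> card (singletons \<pi>) = s}"
  by (auto simp: NC_singletons_def NC_blocks_def singletons_def)

lemma NC_D:
  assumes "\<pi> \<in> NC n"
  shows "partition_on {1..n} \<pi>" "noncrossing \<pi>" "finite \<pi>" "\<Union>\<pi> = {1..n}"
  using assms finite_elements[of "{1..n}" \<pi>] by (auto simp: NC_def partition_on_def)

text \<open>Here \<open>A\<close> accompanies \<open>Suc i\<close>, so that after the transposition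
  it accompanies \<open>i\<close>, as in the definition of \<open>skein\<close>.\<close>

lemma adjacent_blocks_cases:
  assumes \<pi>: "partition_on {1..n} \<pi>" and i: "1 \<le> i" "i < n"
    and ne: "block_of \<pi> i \<noteq> block_of \<pi> (i + 1)" and sing: "{i} \<notin> \<pi>" "{i + 1} \<notin> \<pi>"
  obtains R A B where "adjacent_blocks i R A B"
    "\<pi> = insert (insert (Suc i) A) (insert (insert i B) R)"
proof -
  have "\<exists>X\<in>\<pi>. x \<in> X" if "x \<in> {1..n}" for x using \<pi> that unfolding partition_on_def by blast
  then obtain X Y where X: "X \<in> \<pi>" "Suc i \<in> X" and Y: "Y \<in> \<pi>" "i \<in> Y"
    using i by (metis One_nat_def Suc_leI atLeastAtMost_iff le_SucI less_imp_le)
  have "X \<noteq> Y" using ne block_of_eq[OF \<pi>] X Y by auto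
  have dj: "U \<inter> V = {}" if "U \<in> \<pi>" "V \<in> \<pi>" "U \<noteq> V" for U V
    using partition_onD2[OF \<pi>] that by (meson disjointD)
  have fin: "finite U" if "U \<in> \<pi>" for U
    using that \<pi> by (metis Sup_upper finite_atLeastAtMost partition_on_def rev_finite_subset)
  define R A B where "R = \<pi> - {X, Y}" and "A = X - {Suc i}" and "B = Y - {i}"
  have ins: "X = insert (Suc i) A" "Y = insert i B" using X Y by (auto simp: A_def B_def)
  have XY: "X \<inter> Y = {}" using dj X Y \<open>X \<noteq> Y\<close> by blast
  have "adjacent_blocks i R A B"
  proof
    show "disjoint R" using partition_onD2[OF \<pi>] by (auto simp: R_def disjoint_def)
    show "{} \<notin> R" using partition_onD3[OF \<pi>] by (simp add: R_def)
    show "finite R" using finite_elements[OF _ \<pi>] by (simp add: R_def)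
    show "finite A" "finite B" using fin X Y by (auto simp: A_def B_def)
    have "\<Union>R \<inter> (X \<union> Y) = {}" using dj X Y unfolding R_def by blast
    then show "\<Union>R \<inter> ({i, Suc i} \<union> A \<union> B) = {}" using ins by auto
    show "A \<inter> B = {}" "i \<notin> A" "Suc i \<notin> A" "i \<notin> B" "Suc i \<notin> B"
      using XY X Y by (auto simp: A_def B_def)
    show "A \<noteq> {}" "B \<noteq> {}" using sing X Y ins by auto
  qed
  moreover have "\<pi> = insert (insert (Suc i) A) (insert (insert i B) R)"
    using X Y ins by (auto simp: R_def)
  ultimately show thesis by (rule that)
qed

text \<open>The transposed partition crosses, so \<open>tau_basis\<close> is its skein resolution.
  Both \<open>i\<close> and \<open>i + 1\<close> lie in nonsingleton blocks, and the resulting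
  Vandermonde sign is the one required by \<open>partition_form_relation\<close>.\<close>

lemma (in adjacent_blocks) tau_basis_resolution:
  assumes NC: "insert (insert (Suc i) A) (insert (insert i B) R) \<in> NC n" (is "?\<pi> \<in> _")
  shows "tau_basis i ?\<pi> \<in> int_span (NC_singletons n (card ?\<pi>) (card (singletons ?\<pi>)))"
    and "form_sum (tau_basis i ?\<pi>) p = partition_form ?\<pi> (act (adj_transp i) p)"
proof -
  let ?\<pi>' = "insert (insert i A) (insert (insert (Suc i) B) R)"
  have blocks: "block_of ?\<pi> i = insert i B" "block_of ?\<pi> (Suc i) = insert (Suc i) A"
    by (rule block_of_pair; simp)+
  have sw: "perm_partition (adj_transp i) ?\<pi> = ?\<pi>'"
    by (simp add: perm_partition_pair adj_transp_image del: image_insert)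
  note nc = noncrossing_resolution[OF NC_D(2)[OF NC]]
  have tau: "tau_basis i ?\<pi> = skein i ?\<pi>'"
    using nc(4) fresh by (auto simp: tau_basis_def blocks sw)
  have S: "\<Union>R \<union> W = {1..n}"
    using splits_partition_on[OF splits_simps(2)] NC_D(1)[OF NC] by (simp add: partition_on_def)
  let ?K = "NC_singletons n (card ?\<pi>) (card (singletons ?\<pi>))"
  \<comment> \<open>The surviving terms, like \<open>?\<pi>\<close> itself, have two nonsingleton
    blocks beside \<open>R\<close>; this is why both counts are preserved.\<close>
  have in_K: "insert X (insert Y R) \<in> ?K"
    if "splits X Y" "noncrossing (insert X (insert Y R))" "card X \<noteq> 1" "card Y \<noteq> 1" for X Y
    using that splits_partition_on[OF that(1)] splits_card[OF that(1)] splits_singletons[OF that(1)]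
      splits_card[OF splits_simps(2)] splits_singletons[OF splits_simps(2)] S
    by (simp add: NC_singletons_alt NC_def)
  have pieces: "?\<pi> \<in> ?K" "insert {i, Suc i} (insert (A \<union> B) R) \<in> ?K"
    "card B \<noteq> 1 \<Longrightarrow> insert ({i, Suc i} \<union> A) (insert B R) \<in> ?K"
    "card A \<noteq> 1 \<Longrightarrow> insert ({i, Suc i} \<union> B) (insert A R) \<in> ?K"
    using NC in_K[OF splits_simps(3) nc(1)] in_K[OF splits_simps(4) nc(2)] in_K[OF splits_simps(5) nc(3)]
    by (simp_all add: NC_singletons_alt)
  show "tau_basis i ?\<pi> \<in> int_span ?K"
    unfolding tau skein_pair using pieces by (auto intro!: int_span_diff int_span_add)
  have "insert i B \<in> nonsingletons ?\<pi>" "insert (Suc i) A \<in> nonsingletons ?\<pi>"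
    by (simp_all add: nonsingletons_def)
  then have both: "i \<in> \<Union>(nonsingletons ?\<pi>) \<and> i + 1 \<in> \<Union>(nonsingletons ?\<pi>)"
    by (metis Suc_eq_plus1 UnionI insertI1)
  have fin: "finite (\<Union>?\<pi>)" using NC_D(4)[OF NC] by (metis finite_atLeastAtMost)
  have "partition_form ?\<pi> (act (adj_transp i) p) = - partition_form ?\<pi>' p"
    unfolding partition_form_adj_transp[OF NC_D(3)[OF NC] fin] sw if_P[OF both] by simp
  then show "form_sum (tau_basis i ?\<pi>) p = partition_form ?\<pi> (act (adj_transp i) p)"
    unfolding tau skein_pair using partition_form_relation[of p]
    by (auto simp: form_sum_add form_sum_diff form_sum_0)
qed

lemma tau_basis_properties:
  assumes NC: "\<pi> \<in> NC n" and i: "1 \<le> i" "i < n"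
  shows "tau_basis i \<pi> \<in> int_span (NC_singletons n (card \<pi>) (card (singletons \<pi>)))"
    and "form_sum (tau_basis i \<pi>) p = partition_form \<pi> (act (adj_transp i) p)"
proof -
  let ?s = "adj_transp i" and ?K = "NC_singletons n (card \<pi>) (card (singletons \<pi>))"
  note \<pi> = NC_D[OF NC]
  have mem: "\<pi> \<in> ?K" using NC by (simp add: NC_singletons_alt)
  have fin: "finite (\<Union>\<pi>)" using \<pi>(4) by simp
  have in_block: "x \<in> block_of \<pi> x \<and> block_of \<pi> x \<in> \<pi>" if "x \<in> {1..n}" for x
    using that \<pi>(4) block_of_eq[OF \<pi>(1)] by blast
  have ii: "i \<in> block_of \<pi> i" "block_of \<pi> i \<in> \<pi>" "i + 1 \<in> block_of \<pi> (i + 1)" "block_of \<pi> (i + 1) \<in> \<pi>"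
    using in_block[of i] in_block[of "i + 1"] i by auto
  have goal: "tau_basis i \<pi> \<in> int_span ?K \<and> form_sum (tau_basis i \<pi>) p = partition_form \<pi> (act (adj_transp i) p)"
  proof -
    \<comment> \<open>For different blocks, the transposed partition is noncrossing exactly when
      \<open>i\<close> or \<open>i + 1\<close> is a singleton block, so these cases are the clauses
      of \<open>tau_basis\<close>.\<close>
    consider (same) "block_of \<pi> i = block_of \<pi> (i + 1)"
      | (single) "block_of \<pi> i \<noteq> block_of \<pi> (i + 1)" "{i} \<in> \<pi> \<or> {i + 1} \<in> \<pi>"
      | (crossing) "block_of \<pi> i \<noteq> block_of \<pi> (i + 1)" "{i} \<notin> \<pi>" "{i + 1} \<notin> \<pi>"
      by blast
    then show ?thesis
    proof cases
      case same
      then have tau: "tau_basis i \<pi> = - basis_vec \<pi>" by (simp add: tau_basis_def)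
      let ?X = "block_of \<pi> i"
      have X: "i \<in> ?X" "i + 1 \<in> ?X" "?X \<in> \<pi>" using ii same by auto
      have "?s ` Y = Y" if "Y \<in> \<pi>" for Y
      proof -
        have "i \<in> Y \<longleftrightarrow> i + 1 \<in> Y" using that X block_of_eq[OF \<pi>(1)] same by metis
        then show ?thesis by (force simp: adj_transp_def transpose_def image_iff split: if_splits)
      qed
      then have sw: "perm_partition ?s \<pi> = \<pi>" by (simp add: perm_partition_def)
      have "card ?X \<noteq> 1" using X by (auto simp: card_1_singleton_iff)
      then have "i \<in> \<Union>(nonsingletons \<pi>) \<and> i + 1 \<in> \<Union>(nonsingletons \<pi>)"
        using X unfolding nonsingletons_def by blast
      then have "partition_form \<pi> (act ?s p) = - partition_form \<pi> p"
        using partition_form_adj_transp[OF \<pi>(3) fin, of i p] sw by simp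
      then show ?thesis using mem by (auto simp: tau form_sum_uminus)
    next
      case single
      have nc: "noncrossing (perm_partition ?s \<pi>)"
        using noncrossing_adj_transp_singleton[OF \<pi>(2,1) single(2)] .
      then have tau: "tau_basis i \<pi> = basis_vec (perm_partition ?s \<pi>)"
        using single by (simp add: tau_basis_def)
      have inj: "inj_on ((`) ?s) S" for S
        using inj_image_bij[OF bij_adj_transp] by (rule inj_on_subset) simp
      have "{} \<notin> (`) ?s ` \<pi>" using partition_onD3[OF \<pi>(1)] by auto
      then have "partition_on (?s ` {1..n}) (perm_partition ?s \<pi>)"
        using partition_on_inj_image[OF \<pi>(1) inj_on_subset[OF bij_is_inj[OF bij_adj_transp]], of i]
        by (simp add: perm_partition_def)
      moreover have "?s ` {1..n} = {1..n}"
        unfolding adj_transp_def by (rule permutes_image[OF permutes_swap_id]) (use i in auto)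
      moreover have "card (perm_partition ?s \<pi>) = card \<pi>" "card (singletons (perm_partition ?s \<pi>)) = card (singletons \<pi>)"
        unfolding singletons_perm_partition[OF bij_adj_transp] by (simp_all add: perm_partition_def card_image inj)
      ultimately have "perm_partition ?s \<pi> \<in> ?K" using nc by (simp add: NC_singletons_alt NC_def)
      moreover have "\<not> (i \<in> \<Union>(nonsingletons \<pi>) \<and> i + 1 \<in> \<Union>(nonsingletons \<pi>))"
      proof -
        have "X \<notin> nonsingletons \<pi>" if "{x} \<in> \<pi>" "x \<in> X" for x X
          using that block_of_eq[OF \<pi>(1)] unfolding nonsingletons_def
          by (metis (mono_tags, lifting) is_singletonI is_singleton_altdef mem_Collect_eq singletonI)
        then show ?thesis using single(2) by blast
      qed
      ultimately show ?thesis
        using partition_form_adj_transp[OF \<pi>(3) fin, of i p] by (auto simp: tau)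
    next
      case crossing
      obtain R A B where "adjacent_blocks i R A B" and eq: "\<pi> = insert (insert (Suc i) A) (insert (insert i B) R)"
        by (rule adjacent_blocks_cases[OF \<pi>(1) i crossing])
      then interpret adjacent_blocks i R A B by simp
      show ?thesis using tau_basis_resolution NC unfolding eq by blast
    qed
  qed
  then show "tau_basis i \<pi> \<in> int_span ?K" "form_sum (tau_basis i \<pi>) p = partition_form \<pi> (act (adj_transp i) p)"
    by auto
qed

section \<open>Linear independence\<close>

text \<open>
  Otherwise count the block minima and the block maxima in \<open>{Min X'..<x}\<close>: every block of \<open>P\<close>
  opening there also closes there, whereas in \<open>P'\<close> every block closing there also opens there
  and \<open>X'\<close> opens there without closing.
\<close>

lemma noncrossing_partition_Min_not_less:
  assumes P: "partition_on D P" "noncrossing P" and P': "partition_on D P'" "noncrossing P'"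
    and fin: "finite D" and Min_eq: "Min ` P = Min ` P'" and Max_eq: "Max ` P = Max ` P'"
    and X: "X \<in> P" "x \<in> X" and X': "X' \<in> P'" "x \<in> X'"
  shows "\<not> Min X < Min X'"
proof
  assume less: "Min X < Min X'"
  have mm: "finite C" "C \<noteq> {}" "Min C \<in> C" "Max C \<in> C" "\<And>y. y \<in> C \<Longrightarrow> Min C \<le> y \<and> y \<le> Max C"
    if "C \<in> P \<or> C \<in> P'" for C
  proof -
    show f: "finite C" using that P P' fin by (metis Sup_upper partition_on_def rev_finite_subset)
    show ne: "C \<noteq> {}" using that P P' by (auto simp: partition_on_def)
    show "Min C \<in> C" "Max C \<in> C" "\<And>y. y \<in> C \<Longrightarrow> Min C \<le> y \<and> y \<le> Max C" using f ne by auto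
  qed
  have eqI: "C = C'" if "y \<in> C" "y \<in> C'" "C \<in> P \<and> C' \<in> P \<or> C \<in> P' \<and> C' \<in> P'" for C C' y
    using that P(1) P'(1) by (meson disjointD disjoint_iff partition_onD2)
  have finP: "finite P" "finite P'" using P P' fin finite_elements by auto
  define I S T where "I = {Min X'..<x}" and "S = Min ` P" and "T = Max ` P"
  have "Min X' \<in> Min ` P" using X' Min_eq by blast
  then obtain C0 where C0: "C0 \<in> P" "Min C0 = Min X'" by auto
  \<comment> \<open>If \<open>x\<close> were the minimum of \<open>X'\<close>, the block
    \<open>C0\<close> would contain \<open>x\<close> and so be \<open>X\<close>, whose minimum is
    smaller.\<close>
  have "Min X' \<noteq> x" using eqI[of x C0 X] mm(3)[of C0] C0 X less by auto
  then have lt: "Min X' < x" using mm(5)[of X' x] X' by auto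
  have "S \<inter> I = Min ` {C \<in> P. Min C \<in> I}" by (auto simp: S_def)
  then have "card (S \<inter> I) \<le> card {C \<in> P. Min C \<in> I}" using finP by (simp add: card_image_le)
  also have "\<dots> = card (Max ` {C \<in> P. Min C \<in> I})"
  proof (rule card_image[symmetric], rule inj_onI)
    fix C C' assume "C \<in> {C \<in> P. Min C \<in> I}" "C' \<in> {C \<in> P. Min C \<in> I}" "Max C = Max C'"
    then show "C = C'" using eqI[of "Max C" C C'] mm(4)[of C] mm(4)[of C'] by auto
  qed
  also have "\<dots> \<le> card (T \<inter> I)"
  proof (rule card_mono, use finP in \<open>simp add: T_def\<close>, rule image_subsetI)
    fix C assume "C \<in> {C \<in> P. Min C \<in> I}"
    then have C: "C \<in> P" "Min X' \<le> Min C" "Min C < x" by (auto simp: I_def)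
    have ne: "C \<noteq> X" using C less by auto
    \<comment> \<open>A maximum beyond \<open>x\<close> would give the crossing
      \<open>Min X < Min C < x < Max C\<close>.\<close>
    have "uncrossed X C" using P(2) C X ne unfolding noncrossing_iff by blast
    then have "\<not> x < Max C"
      using C less X mm(3)[of X] mm(3)[of C] mm(4)[of C] unfolding uncrossed_iff
      by (meson less_le_trans)
    moreover have "Max C \<noteq> x" using eqI[of x C X] mm(4)[of C] C X ne by auto
    moreover have "Min C \<le> Max C" using mm C by auto
    ultimately show "Max C \<in> T \<inter> I" using C by (auto simp: T_def I_def)
  qed
  also have "\<dots> \<le> card {C \<in> P'. Max C \<in> I}"
  proof -
    have "T \<inter> I = Max ` {C \<in> P'. Max C \<in> I}" by (auto simp: T_def Max_eq)
    then show ?thesis using finP by (simp add: card_image_le)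
  qed
  also have "\<dots> = card (Min ` {C \<in> P'. Max C \<in> I})"
  proof (rule card_image[symmetric], rule inj_onI)
    fix C C' assume "C \<in> {C \<in> P'. Max C \<in> I}" "C' \<in> {C \<in> P'. Max C \<in> I}" "Min C = Min C'"
    then show "C = C'" using eqI[of "Min C" C C'] mm(3)[of C] mm(3)[of C'] by auto
  qed
  also have "\<dots> \<le> card (S \<inter> I - {Min X'})"
  proof (rule card_mono, use finP in \<open>simp add: S_def\<close>, rule image_subsetI)
    fix C assume "C \<in> {C \<in> P'. Max C \<in> I}"
    then have C: "C \<in> P'" "Min X' \<le> Max C" "Max C < x" by (auto simp: I_def)
    have ne: "C \<noteq> X'" using C mm(5)[of X' x] X' by auto
    have "Max C \<noteq> Min X'" "Min C \<noteq> Min X'"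
      using eqI[of "Min X'" C X'] ne C X' mm(3)[of X'] mm(4)[of C] mm(3)[of C] by auto
    \<comment> \<open>A minimum below \<open>Min X'\<close> would give the crossing
      \<open>Min C < Min X' < Max C < x\<close>.\<close>
    moreover have "uncrossed C X'" using P'(2) C X' ne unfolding noncrossing_iff by blast
    then have "\<not> (Min C < Min X' \<and> Min X' < Max C)"
      using C X' mm(3)[of X'] mm(3)[of C] mm(4)[of C] unfolding uncrossed_iff by meson
    moreover have "Min C \<le> Max C" using mm C by auto
    ultimately show "Min C \<in> S \<inter> I - {Min X'}" using C by (auto simp: S_def I_def Min_eq)
  qed
  also have "\<dots> < card (S \<inter> I)"
  proof (rule psubset_card_mono)
    show "finite (S \<inter> I)" using finP by (simp add: S_def)
    have "Min X' \<in> S \<inter> I" using \<open>Min X' \<in> Min ` P\<close> lt by (simp add: S_def I_def)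
    then show "S \<inter> I - {Min X'} \<subset> S \<inter> I" by blast
  qed
  finally show False by simp
qed

text \<open>Applying the preceding lemma in both directions shows that the two blocks through a
  point have the same minimum, and within each partition a block is determined by its
  minimum.\<close>

lemma noncrossing_partition_eqI:
  assumes P: "partition_on D P" "noncrossing P" and P': "partition_on D P'" "noncrossing P'"
    and fin: "finite D" and Min_eq: "Min ` P = Min ` P'" and Max_eq: "Max ` P = Max ` P'"
  shows "P = P'"
proof -
  have sub: "Q \<subseteq> Q'"
    if Q: "partition_on D Q" "noncrossing Q" and Q': "partition_on D Q'" "noncrossing Q'"
      and e: "Min ` Q = Min ` Q'" "Max ` Q = Max ` Q'" for Q Q'
  proof
    fix X assume X: "X \<in> Q"
    have "X \<noteq> {}" using X Q(1) by (auto simp: partition_on_def)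
    then obtain x where x: "x \<in> X" by blast
    have cover: "\<exists>Y\<in>Q'. y \<in> Y" "\<exists>Y\<in>Q. y \<in> Y" if "y \<in> D" for y
      using Q Q' that unfolding partition_on_def by blast+
    have inD: "y \<in> D" if "y \<in> Y" "Y \<in> Q \<or> Y \<in> Q'" for y Y
      using that Q Q' unfolding partition_on_def by blast
    have M: "Min Y = Min Y'" if "Y \<in> Q" "Y' \<in> Q'" "y \<in> Y" "y \<in> Y'" for Y Y' y
      using noncrossing_partition_Min_not_less[OF Q Q' fin e] that
        noncrossing_partition_Min_not_less[OF Q' Q fin e[symmetric]] by (meson linorder_neqE_nat)
    have same: "Y = Y'" if "Y \<in> Q \<and> Y' \<in> Q \<or> Y \<in> Q' \<and> Y' \<in> Q'" "Min Y = Min Y'" for Y Y'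
    proof -
      have "finite Y" "finite Y'" using that(1) Q Q' fin by (metis Sup_upper partition_on_def rev_finite_subset)+
      moreover have "Y \<noteq> {}" "Y' \<noteq> {}" using that(1) Q Q' by (auto simp: partition_on_def)
      ultimately have "Min Y \<in> Y" "Min Y \<in> Y'" using that(2) by (metis Min_in)+
      then show ?thesis using that(1) Q Q' by (meson disjointD disjoint_iff partition_onD2)
    qed
    obtain X' where X': "X' \<in> Q'" "x \<in> X'" using cover inD x X by blast
    have "X = X'"
    proof (intro subset_antisym subsetI)
      fix y assume y: "y \<in> X"
      then obtain Y where "Y \<in> Q'" "y \<in> Y" using cover inD X by blast
      then show "y \<in> X'" using M[OF X _ y] M[OF X X'(1) x X'(2)] same X' by metis
    next
      fix y assume y: "y \<in> X'"
      then obtain Y where "Y \<in> Q" "y \<in> Y" using cover inD X' by blast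
      then show "y \<in> X" using M[OF _ X'(1) _ y] M[OF X X'(1) x X'(2)] same X by metis
    qed
    then show "X \<in> Q'" using X' by simp
  qed
  show ?thesis using sub[OF P P' Min_eq Max_eq] sub[OF P' P Min_eq[symmetric] Max_eq[symmetric]] by blast
qed

text \<open>The two sums are kept apart because maxima and minima are matched with probe points by
  different permutations.\<close>

definition spread :: "nat set set \<Rightarrow> int"
  where "spread \<pi> = (\<Sum>B\<in>nonsingletons \<pi>. int (Max B)) - (\<Sum>B\<in>nonsingletons \<pi>. int (Min B))"

text \<open>The singleton blocks are recovered as the points of \<open>{1..n}\<close> outside the
  nonsingleton blocks.\<close>

lemma NC_eqI:
  assumes "\<pi> \<in> NC n" "\<pi>' \<in> NC n" "nonsingletons \<pi> = nonsingletons \<pi>'"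
  shows "\<pi> = \<pi>'"
proof -
  have "singletons \<pi> = (\<lambda>x. {x}) ` ({1..n} - \<Union>(nonsingletons \<pi>))" if "\<pi> \<in> NC n" for \<pi>
  proof (intro subset_antisym subsetI)
    fix Y assume "Y \<in> singletons \<pi>"
    then obtain x where x: "Y = {x}" "{x} \<in> \<pi>" by (auto simp: singletons_def card_1_singleton_iff)
    have "x \<notin> Z" if "Z \<in> nonsingletons \<pi>" for Z
      using that x block_of_eq[OF NC_D(1)[OF \<open>\<pi> \<in> NC n\<close>]] unfolding nonsingletons_def
      by (metis (mono_tags, lifting) is_singletonI is_singleton_altdef mem_Collect_eq singletonI)
    then show "Y \<in> (\<lambda>x. {x}) ` ({1..n} - \<Union>(nonsingletons \<pi>))"
      using x NC_D(4)[OF \<open>\<pi> \<in> NC n\<close>] by blast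
  next
    fix Y assume "Y \<in> (\<lambda>x. {x}) ` ({1..n} - \<Union>(nonsingletons \<pi>))"
    then obtain x where x: "Y = {x}" "x \<in> {1..n}" "x \<notin> \<Union>(nonsingletons \<pi>)" by blast
    then obtain Z where "Z \<in> \<pi>" "x \<in> Z" using NC_D(4)[OF \<open>\<pi> \<in> NC n\<close>] by blast
    with x have "card Z = 1" by (auto simp: nonsingletons_def)
    with \<open>x \<in> Z\<close> x have "Z = Y" by (auto simp: card_1_singleton_iff)
    then show "Y \<in> singletons \<pi>" using \<open>card Z = 1\<close> \<open>Z \<in> \<pi>\<close> by (auto simp: singletons_def)
  qed
  then have "singletons \<pi> = singletons \<pi>'" using assms by simp
  moreover have "\<pi> = nonsingletons \<pi> \<union> singletons \<pi>" for \<pi>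
    by (auto simp: nonsingletons_def singletons_def)
  ultimately show ?thesis using assms(3) by metis
qed

lemma nonsingletons_NC:
  assumes "\<pi> \<in> NC n"
  shows "partition_on (\<Union>(nonsingletons \<pi>)) (nonsingletons \<pi>)" "noncrossing (nonsingletons \<pi>)"
    "finite (nonsingletons \<pi>)" "finite (\<Union>(nonsingletons \<pi>))"
proof -
  note \<pi> = NC_D[OF assms]
  show "partition_on (\<Union>(nonsingletons \<pi>)) (nonsingletons \<pi>)"
    using \<pi>(1) by (auto simp: partition_on_def nonsingletons_def disjoint_def)
  show "noncrossing (nonsingletons \<pi>)" using \<pi>(2) by (auto simp: noncrossing_iff nonsingletons_def)
  show "finite (nonsingletons \<pi>)" using \<pi>(3) by (simp add: nonsingletons_def)
  have "\<Union>(nonsingletons \<pi>) \<subseteq> {1..n}" using \<pi>(4) by (auto simp: nonsingletons_def)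
  then show "finite (\<Union>(nonsingletons \<pi>))" by (rule finite_subset) simp
qed

text \<open>Probing at the minima and maxima of the nonsingleton blocks makes the pairing triangular
  with respect to \<open>spread\<close>.\<close>

lemma triangular_probe:
  assumes \<pi>: "\<pi> \<in> NC n"
  obtains p where "partition_form \<pi> p \<noteq> 0"
    "\<And>\<pi>'. \<pi>' \<in> NC n \<Longrightarrow> partition_form \<pi>' p \<noteq> 0 \<Longrightarrow> spread \<pi>' \<le> spread \<pi> \<Longrightarrow> \<pi>' = \<pi>"
proof -
  let ?N = "nonsingletons \<pi>"
  note N = nonsingletons_NC[OF \<pi>]
  obtain Bs where Bs: "distinct Bs" "set Bs = ?N" using N(3) finite_distinct_list by blast
  define k s t where "k = length Bs" and "s j = Min (Bs ! j)" and "t j = Max (Bs ! j)" for j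
  have k: "card ?N = k" using Bs by (metis distinct_card k_def)
  have blk: "Bs ! j \<in> ?N" if "j < k" for j using that Bs by (metis k_def nth_mem)
  have ne: "finite B" "B \<noteq> {}" "Min B \<in> B" "Max B \<in> B" "Min B \<noteq> Max B" if "B \<in> ?N" for B
  proof -
    show f: "finite B" using that N(4) by (meson Sup_upper rev_finite_subset)
    show ne: "B \<noteq> {}" using that N(1) by (auto simp: partition_on_def)
    show "Min B \<in> B" "Max B \<in> B" using f ne by auto
    show "Min B \<noteq> Max B"
    proof
      assume "Min B = Max B"
      then have "B = {Min B}" using f ne by (metis Max_ge Min_in Min_le antisym insertI1 insert_absorb singletonI subsetI subset_antisym singletonD)
      then have "card B = 1" by (metis is_singletonI is_singleton_altdef)
      then show False using that by (simp add: nonsingletons_def)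
    qed
  qed
  have disj: "s a \<noteq> t b" if "a < k" "b < k" for a b
  proof
    assume e: "s a = t b"
    then have "Bs ! a = Bs ! b"
      using ne(3,4) blk that N(1) unfolding s_def t_def
      by (metis block_of_eq)
    then show False using e ne(5) blk that unfolding s_def t_def by metis
  qed
  \<comment> \<open>The weights \<open>rat_of_nat\<close> are pairwise distinct, so the Vandermonde
    product does not vanish.\<close>
  define p where "p = (rat_of_nat, \<Union>?N, k, s, t)"
  have dj: "disjoint (set Bs)" using N(1) Bs by (simp add: partition_on_def)
  have "indicator_det Bs s = 1" "indicator_det Bs t = 1"
    using Bs dj ne(3,4) blk by (auto intro!: indicator_det_transversal simp: s_def t_def k_def)
  then have "block_form ?N s t = 1" using block_form_set[OF Bs(1), of s t] Bs(2) by simp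
  moreover have "vandermonde rat_of_nat (\<Union>?N) \<noteq> 0"
  proof -
    have "finite {(a, b)\<in>\<Union>?N \<times> \<Union>?N. a < b}"
      by (rule finite_subset[of _ "\<Union>?N \<times> \<Union>?N"]) (use N(4) in auto)
    then show ?thesis by (auto simp: vandermonde_def)
  qed
  ultimately have 1: "partition_form \<pi> p \<noteq> 0" using disj k by (simp add: p_def)
  have 2: "\<pi>' = \<pi>" if \<pi>': "\<pi>' \<in> NC n" and nz: "partition_form \<pi>' p \<noteq> 0" and le: "spread \<pi>' \<le> spread \<pi>" for \<pi>'
  proof -
    let ?N' = "nonsingletons \<pi>'"
    note N' = nonsingletons_NC[OF \<pi>']
    have D: "\<Union>?N = \<Union>?N'" and k': "k = card ?N'" and bf: "block_form ?N' s t \<noteq> 0"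
      using nz by (auto simp: p_def split: if_splits)
    obtain Cs where Cs: "distinct Cs" "set Cs = ?N'" using N'(3) finite_distinct_list by blast
    have lenC: "length Cs = k" using Cs k' by (metis distinct_card)
    have "indicator_det Cs s \<noteq> 0" "indicator_det Cs t \<noteq> 0"
      using bf block_form_set[OF Cs(1), of s t] Cs(2) by auto
    then obtain f g where f: "f permutes {..<k}" "\<And>j. j < k \<Longrightarrow> s (f j) \<in> Cs ! j"
      and g: "g permutes {..<k}" "\<And>j. j < k \<Longrightarrow> t (g j) \<in> Cs ! j"
      by (metis indicator_det_nonzeroE lenC)
    have sum_list: "(\<Sum>B\<in>set Ds. h B) = (\<Sum>j<k. h (Ds ! j))" if "distinct Ds" "length Ds = k" for Ds and h :: "nat set \<Rightarrow> int"
      using sum.reindex_bij_betw[OF bij_betw_nth[OF that(1) refl refl], of h] that(2) by simp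
    have finC: "finite (Cs ! j)" if "j < k" for j
    proof -
      have "Cs ! j \<in> ?N'" using that lenC Cs by (metis nth_mem)
      then show ?thesis using N'(4) by (meson Sup_upper rev_finite_subset)
    qed
    \<comment> \<open>The matched points lie in the blocks of \<open>\<pi>'\<close>, hence between
      their minima and maxima; summation gives \<open>spread \<pi> \<le> spread \<pi>'\<close>. The
      hypothesis \<open>le\<close> then forces equality in every block.\<close>
    have leq: "int (Min (Cs ! j)) \<le> int (s (f j))" "int (t (g j)) \<le> int (Max (Cs ! j))" if "j < k" for j
      using f(2)[OF that] g(2)[OF that] finC[OF that] by auto
    have "(\<Sum>j<k. int (s (f j))) = (\<Sum>j<k. int (s j))" "(\<Sum>j<k. int (t (g j))) = (\<Sum>j<k. int (t j))"
      using sum.permute[OF f(1), of "\<lambda>j. int (s j)"] sum.permute[OF g(1), of "\<lambda>j. int (t j)"] by (simp_all add: o_def)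
    then have sp: "spread \<pi> = (\<Sum>j<k. int (t (g j))) - (\<Sum>j<k. int (s (f j)))"
      unfolding spread_def Bs(2)[symmetric] by (simp add: sum_list Bs(1) k_def[symmetric] s_def t_def)
    have sp': "spread \<pi>' = (\<Sum>j<k. int (Max (Cs ! j))) - (\<Sum>j<k. int (Min (Cs ! j)))"
      unfolding spread_def Cs(2)[symmetric] by (simp add: sum_list Cs(1) lenC)
    have "(\<Sum>j<k. int (Min (Cs ! j))) \<le> (\<Sum>j<k. int (s (f j)))" "(\<Sum>j<k. int (t (g j))) \<le> (\<Sum>j<k. int (Max (Cs ! j)))"
      using leq by (auto intro!: sum_mono)
    then have eqs: "(\<Sum>j<k. int (Min (Cs ! j))) = (\<Sum>j<k. int (s (f j)))" "(\<Sum>j<k. int (t (g j))) = (\<Sum>j<k. int (Max (Cs ! j)))"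
      using le sp sp' by linarith+
    have Mineq: "Min (Cs ! j) = s (f j)" if "j < k" for j
      using sum_mono_inv[OF eqs(1), of j] leq that by auto
    have Maxeq: "Max (Cs ! j) = t (g j)" if "j < k" for j
      using sum_mono_inv[OF eqs(2), of j] leq that by auto
    have img: "h ` set Ds = (\<lambda>j. h (Ds ! j)) ` {..<k}" if "length Ds = k" for h :: "nat set \<Rightarrow> nat" and Ds
      using that by (force simp: set_conv_nth)
    have "Min ` ?N' = (s \<circ> f) ` {..<k}" "Max ` ?N' = (t \<circ> g) ` {..<k}"
      unfolding Cs(2)[symmetric] img[OF lenC] by (auto simp: Mineq Maxeq)
    moreover have "(s \<circ> f) ` {..<k} = s ` {..<k}" "(t \<circ> g) ` {..<k} = t ` {..<k}"
      by (simp_all only: image_comp[symmetric] permutes_image[OF f(1)] permutes_image[OF g(1)])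
    moreover have "Min ` ?N = s ` {..<k}" "Max ` ?N = t ` {..<k}"
      unfolding Bs(2)[symmetric] img[OF k_def[symmetric]] by (auto simp: s_def t_def)
    ultimately have M: "Min ` ?N' = Min ` ?N" "Max ` ?N' = Max ` ?N" by simp_all
    have "?N' = ?N"
      by (rule noncrossing_partition_eqI[OF N'(1,2) N(1)[unfolded D] N(2) N'(4) M])
    then show ?thesis by (rule NC_eqI[OF \<pi>' \<pi>])
  qed
  show thesis by (rule that[OF 1 2])
qed

lemma form_sum_eq_0_imp:
  assumes v: "v \<in> qspace (NC n)" and z: "\<And>p. form_sum v p = 0"
  shows "v = 0"
proof (rule ccontr)
  assume "v \<noteq> 0"
  let ?K = "Poly_Mapping.keys v"
  have K: "finite ?K" "?K \<noteq> {}" "?K \<subseteq> NC n" using v \<open>v \<noteq> 0\<close> by (auto simp: qspace_def)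
  \<comment> \<open>A key of largest \<open>spread\<close>: at its probe the forms of all other keys
    vanish.\<close>
  define \<pi> where "\<pi> = arg_min_on (\<lambda>\<pi>. - spread \<pi>) ?K"
  have \<pi>: "\<pi> \<in> ?K" "\<And>\<pi>'. \<pi>' \<in> ?K \<Longrightarrow> spread \<pi>' \<le> spread \<pi>"
    using arg_min_if_finite[OF K(1,2), of "\<lambda>\<pi>. - spread \<pi>"] by (force simp: \<pi>_def not_less)+
  have "\<pi> \<in> NC n" using \<pi> K by auto
  then obtain p where p: "partition_form \<pi> p \<noteq> 0"
    "\<And>\<pi>'. \<pi>' \<in> NC n \<Longrightarrow> partition_form \<pi>' p \<noteq> 0 \<Longrightarrow> spread \<pi>' \<le> spread \<pi> \<Longrightarrow> \<pi>' = \<pi>"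
    by (rule triangular_probe) blast
  have "form_sum v p = (\<Sum>\<pi>'\<in>{\<pi>}. Poly_Mapping.lookup v \<pi>' * partition_form \<pi>' p)"
    unfolding form_sum_def
    by (rule sum.mono_neutral_right) (use K \<pi> p(2) in auto)
  then show False using z[of p] p(1) \<pi>(1) by (simp add: in_keys_iff)
qed

section \<open>The action of the symmetric group\<close>

lemma adj_transp_permutes: "1 \<le> i \<Longrightarrow> i < n \<Longrightarrow> adj_transp i permutes {1..n}"
  unfolding adj_transp_def by (rule permutes_swap_id) auto

text \<open>Adjacent transpositions generate the symmetric group; the rule asks for closure under
  composition because lifts are composed.\<close>

lemma permutes_adj_transp_induct [consumes 1, case_names id adj comp]:
  assumes w: "w permutes {1..n}" and id: "Q id"
    and adj: "\<And>i. 1 \<le> i \<Longrightarrow> i < n \<Longrightarrow> Q (adj_transp i)"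
    and comp: "\<And>v w. v permutes {1..n} \<Longrightarrow> w permutes {1..n} \<Longrightarrow> Q v \<Longrightarrow> Q w \<Longrightarrow> Q (v \<circ> w)"
  shows "Q w"
proof -
  have less: "Q (transpose a b)" if "1 \<le> a" "a < b" "b \<le> n" for a b
    using that
  proof (induction b)
    case 0
    then show ?case by simp
  next
    case (Suc b)
    show ?case
    proof (cases "a = b")
      case True
      then show ?thesis using adj[of b] Suc by (simp add: adj_transp_def)
    next
      case False
      then have IH: "Q (transpose a b)" using Suc by simp
      have b: "1 \<le> b" "b < n" using Suc False by auto
      have ab: "transpose a b permutes {1..n}" by (rule permutes_swap_id) (use Suc False in auto)
      \<comment> \<open>Conjugation by the adjacent transposition at \<open>b\<close> moves the
        endpoint \<open>b\<close> to \<open>Suc b\<close>.\<close>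
      have eq: "transpose a (Suc b) = adj_transp b \<circ> (transpose a b \<circ> adj_transp b)"
        using False Suc.prems by (auto simp: adj_transp_def fun_eq_iff transpose_def)
      show ?thesis
        unfolding eq using ab b IH by (intro comp adj adj_transp_permutes permutes_compose) auto
    qed
  qed
  have transp: "Q (transpose a b)" if "a \<in> {1..n}" "b \<in> {1..n}" "a \<noteq> b" for a b
    using that less[of a b] less[of b a] by (cases "a < b") (auto simp: transpose_commute)
  show ?thesis using w finite_atLeastAtMost
  proof (induction rule: permutes_induct)
    case id
    show ?case by (rule assms(2))
  next
    case (swap a b p)
    show ?case
      by (rule comp) (use swap transp permutes_swap_id[of a "{1..n}" b] in auto)
  qed
qed

text \<open>
  The operators preserve the number of blocks and of singletons, so unions of
  \<open>NC(n, k, s)\<close>'s span submodules.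
\<close>

definition saturated :: "nat \<Rightarrow> nat set set set \<Rightarrow> bool"
  where "saturated n X \<longleftrightarrow> X \<subseteq> NC n \<and>
    (\<forall>\<pi>\<in>X. NC_singletons n (card \<pi>) (card (singletons \<pi>)) \<subseteq> X)"

lemma saturated_NC:
  "saturated n (NC n)" "saturated n (NC_blocks n k)" "saturated n (NC_singletons n k s)"
  by (auto simp: saturated_def NC_singletons_alt NC_blocks_def)

lemma qspace_mono: "X \<subseteq> Y \<Longrightarrow> qspace X \<subseteq> qspace Y"
  by (auto simp: qspace_def)

lemma subspace_qspace: "qfree.subspace (qspace X)"
  unfolding qfree.subspace_def by (simp add: qspace_iff lookup_add lookup_qscale)

lemma int_span_mono: "X \<subseteq> Y \<Longrightarrow> int_span X \<subseteq> int_span Y"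
  by (auto simp: int_span_def qspace_def)

lemma qspace_sum: "(\<And>x. x \<in> I \<Longrightarrow> f x \<in> qspace X) \<Longrightarrow> sum f I \<in> qspace X"
  using qfree.subspace_sum[OF subspace_qspace] .

lemma tau_lift:
  assumes i: "1 \<le> i" "i < n"
  shows "v \<in> qspace (NC n) \<Longrightarrow> form_sum (tau i v) p = form_sum v (act (adj_transp i) p)"
    and "saturated n X \<Longrightarrow> v \<in> qspace X \<Longrightarrow> tau i v \<in> qspace X"
    and "saturated n X \<Longrightarrow> v \<in> int_span X \<Longrightarrow> tau i v \<in> int_span X"
proof -
  assume "v \<in> qspace (NC n)"
  then have "form_sum (tau i v) p = (\<Sum>\<pi>\<in>Poly_Mapping.keys v. Poly_Mapping.lookup v \<pi> * partition_form \<pi> (act (adj_transp i) p))"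
    unfolding tau_def linear_extension_def form_sum_sum form_sum_qscale
    by (intro sum.cong) (auto simp: qspace_def subset_iff tau_basis_properties(2)[OF _ i])
  then show "form_sum (tau i v) p = form_sum v (act (adj_transp i) p)"
    by (simp add: form_sum_def)
next
  have tb: "tau_basis i \<pi> \<in> int_span X" if "saturated n X" "\<pi> \<in> X" for \<pi> X
    using tau_basis_properties(1)[of \<pi> n i] i that int_span_mono unfolding saturated_def by blast
  show "tau i v \<in> qspace X" if "saturated n X" "v \<in> qspace X"
    unfolding tau_def linear_extension_def
  proof (rule qspace_sum)
    fix \<pi> assume "\<pi> \<in> Poly_Mapping.keys v"
    then have "\<pi> \<in> X" using that by (auto simp: qspace_def)
    then have "tau_basis i \<pi> \<in> qspace X" using tb that int_span_subset_qspace by blast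
    then show "qscale (Poly_Mapping.lookup v \<pi>) (tau_basis i \<pi>) \<in> qspace X"
      by (rule qfree.subspace_scale[OF subspace_qspace])
  qed
  show "tau i v \<in> int_span X" if "saturated n X" "v \<in> int_span X"
    unfolding tau_def linear_extension_def
  proof (rule int_span_sum)
    fix \<pi> assume "\<pi> \<in> Poly_Mapping.keys v"
    then have "\<pi> \<in> X" using that by (auto simp: int_span_def qspace_def)
    moreover have "Poly_Mapping.lookup v \<pi> \<in> \<int>" using that by (simp add: int_span_def)
    ultimately show "qscale (Poly_Mapping.lookup v \<pi>) (tau_basis i \<pi>) \<in> int_span X"
      using tb that by (blast intro: int_span_qscale)
  qed
qed

text \<open>\<open>L\<close> realises precomposition with \<open>act w\<close> on
  \<open>V(n)\<close>. Invariance of subspaces and lattices is carried along the induction;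
  linearity follows later from injectivity of \<open>form_sum\<close>.\<close>

definition lifts :: "nat \<Rightarrow> (nat \<Rightarrow> nat) \<Rightarrow> ((nat set set \<Rightarrow>\<^sub>0 rat) \<Rightarrow> (nat set set \<Rightarrow>\<^sub>0 rat)) \<Rightarrow> bool"
  where "lifts n w L \<longleftrightarrow>
    (\<forall>v\<in>qspace (NC n). \<forall>p. form_sum (L v) p = form_sum v (act w p)) \<and>
    (\<forall>X. saturated n X \<longrightarrow> L ` qspace X \<subseteq> qspace X \<and> L ` int_span X \<subseteq> int_span X)"

text \<open>Lifts compose along any factorisation into adjacent transpositions. That the result does
  not depend on the factorisation will follow from \<open>form_sum_inj\<close>.\<close>

lemma lift_exists:
  assumes "w permutes {1..n}"
  shows "\<exists>L. lifts n w L"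
  using assms
proof (induction rule: permutes_adj_transp_induct)
  case id
  show ?case by (rule exI[of _ "\<lambda>v. v"]) (auto simp only: lifts_def act_id image_ident)
next
  case (adj i)
  then show ?case using tau_lift[of i n] by (intro exI[of _ "tau i"]) (auto simp: lifts_def)
next
  case (comp v w)
  then obtain L M where LM: "lifts n v L" "lifts n w M" by blast
  have bij: "bij v" "bij w" using comp permutes_bij by blast+
  have "lifts n (v \<circ> w) (L \<circ> M)"
    unfolding lifts_def
  proof (intro conjI ballI allI impI)
    fix x p assume x: "x \<in> qspace (NC n)"
    have "M ` qspace (NC n) \<subseteq> qspace (NC n)"
      using LM(2) saturated_NC(1) unfolding lifts_def by blast
    then have "M x \<in> qspace (NC n)" using x by blast
    then have "form_sum ((L \<circ> M) x) p = form_sum x (act w (act v p))"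
      using LM x unfolding lifts_def by (metis comp_apply)
    then show "form_sum ((L \<circ> M) x) p = form_sum x (act (v \<circ> w) p)"
      by (simp add: act_comp[OF bij])
  next
    fix X assume "saturated n X"
    then show "(L \<circ> M) ` qspace X \<subseteq> qspace X" "(L \<circ> M) ` int_span X \<subseteq> int_span X"
      using LM unfolding lifts_def image_comp[symmetric] by (meson image_mono order_trans)+
  qed
  then show ?case by blast
qed

section \<open>Uniqueness of lifts and the module structure\<close>

lemma form_sum_inj:
  assumes "v \<in> qspace (NC n)" "v' \<in> qspace (NC n)" "\<And>p. form_sum v p = form_sum v' p"
  shows "v = v'"
proof -
  have "v - v' \<in> qspace (NC n)" using assms(1,2) by (rule qfree.subspace_diff[OF subspace_qspace])
  then have "v - v' = 0" by (rule form_sum_eq_0_imp) (simp add: form_sum_diff assms(3))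
  then show ?thesis by simp
qed

text \<open>The choice is harmless, as injectivity determines the values on
  \<open>qspace (NC n)\<close>. The restriction makes the maps extensional, as membership in
  \<open>Bij\<close> demands.\<close>

definition skein_action :: "nat \<Rightarrow> (nat \<Rightarrow> nat) \<Rightarrow> (nat set set \<Rightarrow>\<^sub>0 rat) \<Rightarrow> (nat set set \<Rightarrow>\<^sub>0 rat)"
  where "skein_action n w = restrict (SOME L. lifts n w L) (qspace (NC n))"

lemma skein_action:
  assumes w: "w permutes {1..n}"
  shows "v \<in> qspace (NC n) \<Longrightarrow> form_sum (skein_action n w v) p = form_sum v (act w p)"
    and "saturated n X \<Longrightarrow> v \<in> qspace X \<Longrightarrow> skein_action n w v \<in> qspace X"
    and "saturated n X \<Longrightarrow> v \<in> int_span X \<Longrightarrow> skein_action n w v \<in> int_span X"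
proof -
  define L where "L = (SOME L. lifts n w L)"
  have "lifts n w L" unfolding L_def using lift_exists[OF w] by (rule someI_ex)
  then have L: "\<forall>v\<in>qspace (NC n). \<forall>p. form_sum (L v) p = form_sum v (act w p)"
    "\<And>X. saturated n X \<Longrightarrow> L ` qspace X \<subseteq> qspace X \<and> L ` int_span X \<subseteq> int_span X"
    unfolding lifts_def by blast+
  have eq: "skein_action n w v = L v" if "v \<in> qspace (NC n)" for v
    using that by (simp add: skein_action_def L_def)
  have sub: "qspace X \<subseteq> qspace (NC n)" if "saturated n X" for X
    using that by (intro qspace_mono) (simp add: saturated_def)
  show "form_sum (skein_action n w v) p = form_sum v (act w p)" if "v \<in> qspace (NC n)"
    unfolding eq[OF that] using L(1) that by blast
  show "skein_action n w v \<in> qspace X" if "saturated n X" "v \<in> qspace X"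
    using L(2)[OF that(1)] sub[OF that(1)] eq that(2) by auto
  show "skein_action n w v \<in> int_span X" if "saturated n X" "v \<in> int_span X"
  proof -
    have "v \<in> qspace (NC n)" using that(2) sub[OF that(1)] int_span_subset_qspace by blast
    then show ?thesis using eq L(2)[OF that(1)] that(2) by auto
  qed
qed

text \<open>Reduces identities for the action to identities between functions on probes, where they
  are evident.\<close>

lemma skein_action_eqI:
  assumes "w permutes {1..n}" "v \<in> qspace (NC n)" "v' \<in> qspace (NC n)"
    "\<And>p. form_sum v' p = form_sum v (act w p)"
  shows "skein_action n w v = v'"
  using assms skein_action(1,2)[OF assms(1)] saturated_NC(1) by (intro form_sum_inj) auto

lemma skein_action_comp:
  assumes "v permutes {1..n}" "w permutes {1..n}" "x \<in> qspace (NC n)"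
  shows "skein_action n (v \<circ> w) x = skein_action n v (skein_action n w x)"
  using assms permutes_compose[OF assms(2,1)] skein_action(1,2) saturated_NC(1)
  by (intro skein_action_eqI) (simp_all add: act_comp permutes_bij)

lemma skein_action_id: "x \<in> qspace (NC n) \<Longrightarrow> skein_action n id x = x"
  by (rule skein_action_eqI) (simp_all add: permutes_id act_id)

lemma group_action_skein_action: "group_action (sym_group n) (qspace (NC n)) (skein_action n)"
proof -
  let ?V = "qspace (NC n)"
  have closed: "skein_action n w x \<in> ?V" if "w permutes {1..n}" "x \<in> ?V" for w x
    using skein_action(2)[OF that(1) saturated_NC(1) that(2)] .
  have Bij: "skein_action n w \<in> Bij ?V" if w: "w permutes {1..n}" for w
  proof -
    have "bij_betw (skein_action n w) ?V ?V"
      by (rule bij_betwI[where g = "skein_action n (inv' w)"])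
        (use w permutes_inv[OF w] closed skein_action_comp[symmetric] skein_action_id permutes_inv_o[OF w] in auto)
    then show ?thesis by (simp add: Bij_def skein_action_def)
  qed
  have "skein_action n \<in> hom (sym_group n) (BijGroup ?V)"
  proof (rule homI)
    fix v w assume "v \<in> carrier (sym_group n)" "w \<in> carrier (sym_group n)"
    then have vw: "v permutes {1..n}" "w permutes {1..n}" by (simp_all add: sym_group_carrier)
    have "skein_action n (v \<circ> w) = compose ?V (skein_action n v) (skein_action n w)"
    proof (rule extensionalityI)
      show "skein_action n (v \<circ> w) \<in> extensional ?V" by (simp add: skein_action_def)
    qed (simp_all add: compose_eq skein_action_comp[OF vw])
    then show "skein_action n (v \<otimes>\<^bsub>sym_group n\<^esub> w) = skein_action n v \<otimes>\<^bsub>BijGroup ?V\<^esub> skein_action n w"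
      using Bij vw by (simp add: sym_group_mult BijGroup_def)
  qed (simp add: sym_group_carrier BijGroup_def Bij)
  then show ?thesis
    unfolding group_action_def group_hom_def group_hom_axioms_def
    using sym_group_is_group group_BijGroup by blast
qed

lemma linear_skein_action:
  assumes w: "w permutes {1..n}"
  shows "linear_on_space (qspace (NC n)) (skein_action n w)"
proof -
  note closed = skein_action(2)[OF w saturated_NC(1)] and form = skein_action(1)[OF w]
  note add = qfree.subspace_add[OF subspace_qspace] and scale = qfree.subspace_scale[OF subspace_qspace]
  show ?thesis
    unfolding linear_on_space_def
    by (intro conjI ballI allI skein_action_eqI[OF w])
      (simp_all add: add scale closed form form_sum_add form_sum_qscale)
qed

theorem theorem4p4:
  fixes n :: nat
  shows "\<exists>\<rho>. group_module (sym_group n) (qspace (NC n)) \<rho> \<and>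
    (\<forall>i v. 1 \<le> i \<and> i < n \<and> v \<in> qspace (NC n) \<longrightarrow> \<rho> (adj_transp i) v = tau i v) \<and>
    (\<forall>k s. qspace (NC_singletons n k s) \<subseteq> qspace (NC_blocks n k) \<and>
      group_submodule (sym_group n) (qspace (NC n)) \<rho> (qspace (NC_blocks n k)) \<and>
      group_submodule (sym_group n) (qspace (NC n)) \<rho> (qspace (NC_singletons n k s))) \<and>
    (\<forall>w\<in>carrier (sym_group n).
      integral_matrix (\<rho> w) (NC n) \<and>
      (\<forall>k s. integral_matrix (\<rho> w) (NC_blocks n k) \<and>
             integral_matrix (\<rho> w) (NC_singletons n k s)))"
proof (intro exI[of _ "skein_action n"] conjI allI impI ballI)
  show "group_module (sym_group n) (qspace (NC n)) (skein_action n)"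
    by (simp add: group_module_def subspace_qspace group_action_skein_action linear_skein_action sym_group_carrier)
  \<comment> \<open>By \<open>tau_lift\<close> both sides have the same image under
    \<open>form_sum\<close>.\<close>
  show "skein_action n (adj_transp i) v = tau i v" if "1 \<le> i \<and> i < n \<and> v \<in> qspace (NC n)" for i v
    using that tau_lift[of i n] saturated_NC(1)
    by (intro skein_action_eqI adj_transp_permutes) auto
  show "qspace (NC_singletons n k s) \<subseteq> qspace (NC_blocks n k)" for k s
    by (rule qspace_mono) (auto simp: NC_singletons_def)
  have submodule: "group_submodule (sym_group n) (qspace (NC n)) (skein_action n) (qspace X)" if "saturated n X" for X
    using that skein_action(2) qspace_mono[of X "NC n"]
    by (auto simp: group_submodule_def subspace_qspace sym_group_carrier saturated_def)
  show "group_submodule (sym_group n) (qspace (NC n)) (skein_action n) (qspace (NC_blocks n k))"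
    "group_submodule (sym_group n) (qspace (NC n)) (skein_action n) (qspace (NC_singletons n k s))" for k s
    using submodule saturated_NC by blast+
  have "integral_matrix (skein_action n w) X" if "w \<in> carrier (sym_group n)" "saturated n X" for w X
  proof -
    \<comment> \<open>The columns of the matrix are images of basis vectors, and the action
      preserves the lattice spanned by \<open>X\<close>.\<close>
    have "skein_action n w (basis_vec \<pi>) \<in> int_span X" if "\<pi> \<in> X" for \<pi>
      using skein_action(3)[of w n X] that \<open>w \<in> _\<close> \<open>saturated n X\<close> by (auto simp: sym_group_carrier)
    then show ?thesis by (simp add: integral_matrix_def matrix_entry_def int_span_def)
  qed
  then show "integral_matrix (skein_action n w) (NC n)" "integral_matrix (skein_action n w) (NC_blocks n k)"
    "integral_matrix (skein_action n w) (NC_singletons n k s)" if "w \<in> carrier (sym_group n)" for w k s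
    using that saturated_NC by blast+
qed

end
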